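(* Fix nonzero $u'_1\in\mathbb R^N$, $v_1'\in\mathbb R^p$ and vectors $t_1'\in\mathbb R^N$, $s_1'\in\mathbb R^p$ such that $\langle v_1',s_1'\rangle+\langle u_1',t_1'\rangle=0$. Fix any $\hat\xi_g\in\mathbb R^p$, $\hat\xi_h\in\mathbb R^N$ satisfying $$-\frac{u_1'}{\|u_1'\|_2}\langle\hat\xi_g,v_1'\rangle+\|v_1'\|_2\hat\xi_h-t_1'=0,\qquad -\|u_1'\|_2\hat\xi_g+\frac{v_1'}{\|v_1'\|_2}\langle\hat\xi_h,u_1'\rangle+s_1'=0$$ (such vectors exist). Let $A\in\mathbb R^{N\times p}$ have i.i.d. $N(0,1)$ entries, $\xi_g\sim N(0,I_p)$, $\xi_h\sim N(0,I_N)$, all independent, and define, for $u\in\mathbb R^N$, $v\in\mathbb R^p$, $$g_{\mathrm{cg}}(u)=\frac{\langle u_1',u\rangle}{\|u_1'\|_2}\hat\xi_g+\|\mathsf P_{u_1'}^\perp u\|_2\,\mathsf P_{v_1'}^\perp\xi_g,\qquad h_{\mathrm{cg}}(v)=\frac{\langle v_1',v\rangle}{\|v_1'\|_2}\hat\xi_h+\|\mathsf P_{v_1'}^\perp v\|_2\,\mathsf P_{u_1'}^\perp\xi_h .$$ Let $\mathcal E_{2|1}=\{A^\top u_1'+s_1'=0,\ Av_1'-t_1'=0\}$, and let $\psi:\mathbb R^N\times\mathbb R^p\to\mathbb R$ be continuous, concave in its first argument and convex in its second argument. (i) If $E_u\subset\mathbb R^N$ and $E_v\subset\mathbb R^p$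 are compact, then for any $t\in\mathbb R$ $$\mathbb P\Big(\min_{v\in E_v}\max_{u\in E_u}u^\top Av+\psi(u,v)\le t\,\Big|\,\mathcal E_{2|1}\Big)\le2\,\mathbb P\Big(\min_{v\in E_v}\max_{u\in E_u}-\langle g_{\mathrm{cg}}(u),v\rangle+\langle h_{\mathrm{cg}}(v),u\rangle+\psi(u,v)\le t\Big).$$ (ii) If $E_u\subset\mathbb R^N$ and $E_v\subset\mathbb R^p$ are compact and convex, then for any $t\in\mathbb R$ $$\mathbb P\Big(\min_{v\in E_v}\max_{u\in E_u}u^\top Av+\psi(u,v)\ge t\,\Big|\,\mathcal E_{2|1}\Big)\le2\,\mathbb P\Big(\min_{v\in E_v}\max_{u\in E_u}-\langle g_{\mathrm{cg}}(u),v\rangle+\langle h_{\mathrm{cg}}(v),u\rangle+\psi(u,v)\ge t\Big).$$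
   Context: $\mathsf P_a^\perp=I-aa^\top/\|a\|_2^2$ is the orthogonal projection onto the orthogonal complement of a nonzero vector $a$. Conditioning on $\mathcal E_{2|1}$ means conditioning the Gaussian matrix $A$ on the affine constraints defining $\mathcal E_{2|1}$, i.e. the conditional law of $A$ is the usual Gaussian conditional law: that of $A_0+\mathsf P_{u_1'}^\perp\tilde A\,\mathsf P_{v_1'}^\perp$, where $A_0$ is the minimum Frobenius norm matrix satisfying the constraints and $\tilde A$ has i.i.d. $N(0,1)$ entries. *)

theory Defs
  imports "HOL-Probability.Probability"
begin

text \<open>
  An \<open>N \<times> p\<close> matrix has type \<^typ>\<open>real^'p^'N\<close>; its \<^const>\<open>norm\<close> is the Frobenius norm.
\<close>

definition proj_perp :: "real^'n \<Rightarrow> real^'n^'n" where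
  "proj_perp a = mat 1 - (1 / (norm a)\<^sup>2) *\<^sub>R (\<chi> i j. a $ i * a $ j)"

text \<open>
  \<open>A\<close> has i.i.d. \<open>N(0,1)\<close> entries, \<open>z\<^sub>g \<sim> N(0, I\<^sub>p)\<close>, \<open>z\<^sub>h \<sim> N(0, I\<^sub>N)\<close>, and the three are
  independent: equivalently, all their entries together form one i.i.d. \<open>N(0,1)\<close> family.
\<close>

definition gaussian_entries ::
    "('w \<Rightarrow> real^'p^'N) \<Rightarrow> ('w \<Rightarrow> real^'p) \<Rightarrow> ('w \<Rightarrow> real^'N)
      \<Rightarrow> ('N \<times> 'p) + ('p + 'N) \<Rightarrow> 'w \<Rightarrow> real" where
  "gaussian_entries A zg zh k \<omega> =
     (case k of Inl (i, j) \<Rightarrow> A \<omega> $ i $ j | Inr (Inl j) \<Rightarrow> zg \<omega> $ j | Inr (Inr i) \<Rightarrow> zh \<omega> $ i)"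

definition indep_std_gaussians ::
    "'w measure \<Rightarrow> ('w \<Rightarrow> real^'p^'N) \<Rightarrow> ('w \<Rightarrow> real^'p) \<Rightarrow> ('w \<Rightarrow> real^'N) \<Rightarrow> bool" where
  "indep_std_gaussians M A zg zh \<longleftrightarrow>
     prob_space.indep_vars M (\<lambda>_. borel) (gaussian_entries A zg zh) UNIV \<and>
     (\<forall>k. distributed M lborel (gaussian_entries A zg zh k) std_normal_density)"

definition cond_event :: "real^'N \<Rightarrow> real^'p \<Rightarrow> real^'N \<Rightarrow> real^'p \<Rightarrow> (real^'p^'N) set" where
  "cond_event u1 v1 t1 s1 = {B. transpose B *v u1 + s1 = 0 \<and> B *v v1 - t1 = 0}"

definition min_frobenius :: "real^'N \<Rightarrow> real^'p \<Rightarrow> real^'N \<Rightarrow> real^'p \<Rightarrow> real^'p^'N" where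
  "min_frobenius u1 v1 t1 s1 = arg_min_on norm (cond_event u1 v1 t1 s1)"

text \<open>
  The conditional law of a matrix \<open>A\<close> with i.i.d. \<open>N(0,1)\<close> entries given the null event
  \<^term>\<open>A \<in> cond_event u1 v1 t1 s1\<close> is the law of
  \<open>min_frobenius u1 v1 t1 s1 + proj_perp u1 ** A' ** proj_perp v1\<close>, where \<open>A'\<close> has i.i.d.
  \<open>N(0,1)\<close> entries.  Only the law of \<open>A'\<close> matters and it is that of \<open>A\<close>, so the definition uses
  \<open>A\<close> itself in place of \<open>A'\<close>; it has this meaning only for such an \<open>A\<close>.
\<close>

definition gaussian_cond_law ::
    "'w measure \<Rightarrow> ('w \<Rightarrow> real^'p^'N) \<Rightarrow> real^'N \<Rightarrow> real^'p \<Rightarrow> real^'N \<Rightarrow> real^'p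
      \<Rightarrow> (real^'p^'N) measure" where
  "gaussian_cond_law M A u1 v1 t1 s1 =
     distr M borel (\<lambda>\<omega>. min_frobenius u1 v1 t1 s1 + proj_perp u1 ** A \<omega> ** proj_perp v1)"

definition xi_hat_eqs ::
    "real^'N \<Rightarrow> real^'p \<Rightarrow> real^'N \<Rightarrow> real^'p \<Rightarrow> real^'p \<Rightarrow> real^'N \<Rightarrow> bool" where
  "xi_hat_eqs u1 v1 t1 s1 xg xh \<longleftrightarrow>
     - ((xg \<bullet> v1) *\<^sub>R (u1 /\<^sub>R norm u1)) + norm v1 *\<^sub>R xh - t1 = 0 \<and>
     - (norm u1 *\<^sub>R xg) + (xh \<bullet> u1) *\<^sub>R (v1 /\<^sub>R norm v1) + s1 = 0"

definition g_cg :: "real^'N \<Rightarrow> real^'p \<Rightarrow> real^'p \<Rightarrow> real^'p \<Rightarrow> real^'N \<Rightarrow> real^'p" where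
  "g_cg u1 v1 xg zg u =
     ((u1 \<bullet> u) / norm u1) *\<^sub>R xg + norm (proj_perp u1 *v u) *\<^sub>R (proj_perp v1 *v zg)"

definition h_cg :: "real^'N \<Rightarrow> real^'p \<Rightarrow> real^'N \<Rightarrow> real^'N \<Rightarrow> real^'p \<Rightarrow> real^'N" where
  "h_cg u1 v1 xh zh v =
     ((v1 \<bullet> v) / norm v1) *\<^sub>R xh + norm (proj_perp v1 *v v) *\<^sub>R (proj_perp u1 *v zh)"

definition min_max :: "'b set \<Rightarrow> 'a set \<Rightarrow> ('a \<Rightarrow> 'b \<Rightarrow> real) \<Rightarrow> real" where
  "min_max Ev Eu f = (INF v\<in>Ev. SUP u\<in>Eu. f u v)"

text \<open>
  For jointly continuous functions on nonempty compact sets, the infimum and the supremum in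
  \<^const>\<open>min_max\<close> are attained, so they are a minimum and a maximum.
\<close>

lemma min_max_attained:
  fixes f :: "'a::metric_space \<Rightarrow> 'b::metric_space \<Rightarrow> real"
  assumes f: "continuous_on (Eu \<times> Ev) (\<lambda>(u, v). f u v)"
    and Eu: "compact Eu" "Eu \<noteq> {}" and Ev: "compact Ev" "Ev \<noteq> {}"
  shows "v \<in> Ev \<Longrightarrow> \<exists>u\<in>Eu. f u v = (SUP u\<in>Eu. f u v) \<and> (\<forall>u'\<in>Eu. f u' v \<le> f u v)"
    and "\<exists>v\<in>Ev. (SUP u\<in>Eu. f u v) = min_max Ev Eu f \<and>
      (\<forall>v'\<in>Ev. (SUP u\<in>Eu. f u v) \<le> (SUP u\<in>Eu. f u v'))"
proof -
  define g where "g v = (SUP u\<in>Eu. f u v)" for v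
  have mx: "\<exists>u\<in>Eu. f u v = g v \<and> (\<forall>u'\<in>Eu. f u' v \<le> f u v)" if v: "v \<in> Ev" for v
  proof -
    have "continuous_on Eu (\<lambda>u. (u, v))" by (intro continuous_intros)
    moreover have "(\<lambda>u. (u, v)) ` Eu \<subseteq> Eu \<times> Ev" using v by auto
    ultimately have "continuous_on Eu (\<lambda>u. f u v)"
      using continuous_on_compose2[OF f] by fastforce
    then obtain u where u: "u \<in> Eu" "\<forall>u'\<in>Eu. f u' v \<le> f u v"
      using continuous_attains_sup[OF Eu] by blast
    then have "g v = f u v" unfolding g_def by (intro cSup_eq_maximum) auto
    with u show ?thesis by auto
  qed
  have "uniformly_continuous_on (Eu \<times> Ev) (\<lambda>(u, v). f u v)"
    by (intro compact_uniformly_continuous f compact_Times Eu Ev)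
  then have uc: "\<exists>d>0. \<forall>u\<in>Eu. \<forall>v\<in>Ev. \<forall>v'\<in>Ev. dist v' v < d \<longrightarrow> \<bar>f u v' - f u v\<bar> < e"
    if "e > 0" for e
    using that unfolding uniformly_continuous_on_def
    by (fastforce simp: dist_Pair_Pair dist_real_def)
  have "continuous_on Ev g"
    unfolding continuous_on_iff
  proof (intro ballI allI impI)
    fix v and e :: real assume v: "v \<in> Ev" and e: "0 < e"
    from uc[OF e] obtain d where d: "d > 0"
      "\<And>u v v'. \<lbrakk>u \<in> Eu; v \<in> Ev; v' \<in> Ev; dist v' v < d\<rbrakk> \<Longrightarrow> \<bar>f u v' - f u v\<bar> < e" by blast
    have "dist (g v') (g v) < e" if v': "v' \<in> Ev" "dist v' v < d" for v'
    proof -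
      obtain u where u: "u \<in> Eu" "f u v = g v" "\<forall>w\<in>Eu. f w v \<le> f u v" using mx[OF v] by blast
      obtain u' where u': "u' \<in> Eu" "f u' v' = g v'" "\<forall>w\<in>Eu. f w v' \<le> f u' v'"
        using mx[OF v'(1)] by blast
      have "\<bar>f u v' - f u v\<bar> < e" "\<bar>f u' v' - f u' v\<bar> < e"
        using d(2) u(1) u'(1) v v' by auto
      moreover have "f u' v \<le> f u v" "f u v' \<le> f u' v'" using u u' by auto
      ultimately show ?thesis using u(2) u'(2) by (auto simp: dist_real_def)
    qed
    then show "\<exists>d>0. \<forall>x'\<in>Ev. dist x' v < d \<longrightarrow> dist (g x') (g v) < e" using d(1) by blast
  qed
  then obtain w where w: "w \<in> Ev" "\<forall>v'\<in>Ev. g w \<le> g v'"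
    using continuous_attains_inf[OF Ev] by blast
  then have "min_max Ev Eu f = g w"
    unfolding min_max_def g_def[symmetric] by (intro cInf_eq_minimum) auto
  with w show "\<exists>v\<in>Ev. (SUP u\<in>Eu. f u v) = min_max Ev Eu f \<and>
      (\<forall>v'\<in>Ev. (SUP u\<in>Eu. f u v) \<le> (SUP u\<in>Eu. f u v'))" by (auto simp: g_def)
  show "v \<in> Ev \<Longrightarrow> \<exists>u\<in>Eu. f u v = (SUP u\<in>Eu. f u v) \<and> (\<forall>u'\<in>Eu. f u' v \<le> f u v)"
    using mx by (auto simp: g_def)
qed

text \<open>The minimum norm solution exists and is unique, so \<^const>\<open>min_frobenius\<close> denotes it.\<close>

lemma min_frobenius:
  fixes u1 t1 :: "real^'N" and v1 s1 :: "real^'p"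
  assumes "u1 \<noteq> 0" "v1 \<noteq> 0" and orth: "v1 \<bullet> s1 + u1 \<bullet> t1 = 0"
  shows "min_frobenius u1 v1 t1 s1 \<in> cond_event u1 v1 t1 s1"
    and "\<forall>B\<in>cond_event u1 v1 t1 s1. B \<noteq> min_frobenius u1 v1 t1 s1 \<longrightarrow>
      norm (min_frobenius u1 v1 t1 s1) < norm B"
proof -
  let ?S = "cond_event u1 v1 t1 s1" and ?A = "min_frobenius u1 v1 t1 s1"
  define U V c where "U = u1 \<bullet> u1" and "V = v1 \<bullet> v1" and "c = u1 \<bullet> t1"
  have nz: "U \<noteq> 0" "V \<noteq> 0" using assms by (auto simp: U_def V_def)
  have su: "(\<Sum>i\<in>UNIV. u1 $ i * u1 $ i) = U" "(\<Sum>i\<in>UNIV. t1 $ i * u1 $ i) = c"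
    "(\<Sum>j\<in>UNIV. v1 $ j * v1 $ j) = V" "(\<Sum>j\<in>UNIV. s1 $ j * v1 $ j) = - c"
    using orth by (auto simp: U_def V_def c_def inner_vec_def mult.commute)
  define B :: "real^'p^'N" where "B = (\<chi> i j. t1 $ i * v1 $ j / V - u1 $ i * s1 $ j / U
     - u1 $ i * v1 $ j * c / (U * V))"
  have "B *v v1 = t1"
  proof (rule vec_eq_iff[THEN iffD2], rule allI)
    fix i
    have "(B *v v1) $ i = (\<Sum>j\<in>UNIV. (t1 $ i / V - u1 $ i * c / (U * V)) * (v1 $ j * v1 $ j)
       - u1 $ i / U * (s1 $ j * v1 $ j))"
      unfolding matrix_vector_mult_def B_def
      using nz by (auto intro!: sum.cong simp: divide_simps) (simp add: algebra_simps)?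
    also have "\<dots> = (t1 $ i / V - u1 $ i * c / (U * V)) * V + u1 $ i / U * c"
      unfolding sum_subtractf sum_distrib_left[symmetric] su by simp
    also have "\<dots> = t1 $ i" using nz by (simp add: field_simps)
    finally show "(B *v v1) $ i = t1 $ i" .
  qed
  moreover have "transpose B *v u1 = - s1"
  proof (rule vec_eq_iff[THEN iffD2], rule allI)
    fix j
    have "(transpose B *v u1) $ j = (\<Sum>i\<in>UNIV. v1 $ j / V * (t1 $ i * u1 $ i)
       - (s1 $ j / U + v1 $ j * c / (U * V)) * (u1 $ i * u1 $ i))"
      unfolding matrix_vector_mult_def transpose_def B_def
      using nz by (auto intro!: sum.cong simp: divide_simps) (simp add: algebra_simps)?
    also have "\<dots> = v1 $ j / V * c - (s1 $ j / U + v1 $ j * c / (U * V)) * U"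
      unfolding sum_subtractf sum_distrib_left[symmetric] su by simp
    also have "\<dots> = (- s1) $ j" using nz by (simp add: field_simps)
    finally show "(transpose B *v u1) $ j = (- s1) $ j" .
  qed
  ultimately have "B \<in> ?S" by (simp add: cond_event_def)
  then have ne: "?S \<noteq> {}" by blast
  have lin: "transpose (X + Y) = transpose X + transpose Y"
    "transpose (k *\<^sub>R X) = k *\<^sub>R transpose X" for X Y :: "real^'p^'N" and k
    by (auto simp: transpose_def vec_eq_iff)
  have bl: "linear (\<lambda>X::real^'p^'N. transpose X *v u1)" "linear (\<lambda>X::real^'p^'N. X *v v1)"
    by (auto intro!: linearI simp: lin matrix_vector_mult_add_rdistrib
        scaleR_matrix_vector_assoc[symmetric] simp del: transpose_matrix_vector)
  have "?S = (\<lambda>X. transpose X *v u1) -` {- s1} \<inter> (\<lambda>X. X *v v1) -` {t1}"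
    by (auto simp: cond_event_def add_eq_0_iff2 simp del: transpose_matrix_vector)
  then have cvx: "convex ?S"
    by (metis bl convex_Int convex_linear_vimage convex_singleton)
  have cl: "closed ?S"
    unfolding cond_event_def
    by (intro closed_Collect_conj closed_Collect_eq continuous_intros linear_continuous_on
        bl[THEN linear_conv_bounded_linear[THEN iffD1]])
  define C where "C = closest_point ?S 0"
  have C: "C \<in> ?S" "\<And>X. X \<in> ?S \<Longrightarrow> norm C \<le> norm X"
    using closest_point_exists[OF cl ne, of 0] by (auto simp: C_def)
  have uniq: "X = C" if "X \<in> ?S" "norm X \<le> norm C" for X
    unfolding C_def by (rule closest_point_unique[OF cvx cl that(1)]) (use C(2) that in force)
  have "?A = C"
  proof -
    have "is_arg_min norm (\<lambda>X. X \<in> ?S) C" using C by (force simp: is_arg_min_linorder)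
    then have "is_arg_min norm (\<lambda>X. X \<in> ?S) ?A"
      unfolding min_frobenius_def arg_min_on_def arg_min_def by (rule someI)
    then show ?thesis using uniq C(1) by (auto simp: is_arg_min_linorder)
  qed
  then show "?A \<in> ?S" "\<forall>B\<in>?S. B \<noteq> ?A \<longrightarrow> norm ?A < norm B"
    using C(1) uniq by (auto simp: not_le[symmetric])
qed

end

theory Submission
  imports Defs
begin

text \<open>
  Write \<open>a = proj_perp u1 *v u\<close> and \<open>b = proj_perp v1 *v v\<close>. Under the conditional law the form
  \<open>u \<bullet> (B *v v)\<close> is \<open>a \<bullet> (A *v b)\<close> plus a deterministic bilinear form, and the equations for
  \<open>xg, xh\<close> say exactly that the same deterministic form appears in the comparison process, whose
  random part is \<open>- \<bar>a\<bar> (zg \<bullet> b) + \<bar>b\<bar> (zh \<bullet> a)\<close>. With an extra standard normal \<open>\<gamma>\<close>, the processes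
  \<open>a \<bullet> (A *v b) \<plusminus> \<gamma> \<bar>a\<bar> \<bar>b\<bar>\<close> have the variances of this random part, and their covariances exceed
  its covariances by \<open>(\<bar>a\<bar>\<bar>a'\<bar> - a \<bullet> a') (\<bar>b\<bar>\<bar>b'\<bar> - b \<bullet> b') \<ge> 0\<close>, which vanishes if \<open>a = a'\<close> or \<open>b = b'\<close>. So
  Gordon's comparison inequality applies to both signs; since one of the two signs makes the
  extra term nonpositive, a union bound gives (i) with the factor 2. Gordon's inequality itself
  is obtained by interpolating \<open>cos t * \<alpha> + sin t * \<beta>\<close> between the two processes and integrating by
  parts. Part (ii) is (i) with the roles of the players exchanged: the minimax theorem on the
  matrix side, and only \<open>max min \<le> min max\<close> on the comparison side.
\<close>

subsection \<open>Gaussian integration by parts\<close>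

abbreviation std_normal :: "real measure" where
  "std_normal \<equiv> density lborel (\<lambda>x. ennreal (std_normal_density x))"

abbreviation gauss_prod :: "('k::finite \<Rightarrow> real) measure" where
  "gauss_prod \<equiv> Pi\<^sub>M UNIV (\<lambda>_. std_normal)"

lemma prob_space_std_normal: "prob_space std_normal"
  by (rule prob_space_normal_density) simp

lemma prob_space_gauss_prod: "prob_space (gauss_prod :: ('k::finite \<Rightarrow> real) measure)"
  by (intro prob_space_PiM prob_space_std_normal)

lemma integrable_std_normal_abs: "integrable std_normal (\<lambda>x. \<bar>x\<bar>)"
  using integrable_std_normal_moment_abs[of 1] by (subst integrable_density) auto

text \<open>The density \<open>n\<close> satisfies \<open>n' x = - x * n x\<close>, so
  \<open>n * f' - x * n * f\<close> is the derivative of \<open>n * f\<close>, which vanishes at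
  both ends of the line because \<open>f\<close> is bounded. The bounds also give the integrability
  that lets the integral be split.\<close>

lemma std_normal_stein:
  fixes f f' :: "real \<Rightarrow> real"
  assumes f: "\<And>x. (f has_real_derivative f' x) (at x)"
    and f': "continuous_on UNIV f'"
    and C: "\<And>x. \<bar>f x\<bar> \<le> C" and D: "\<And>x. \<bar>f' x\<bar> \<le> D"
  shows "(\<integral>x. x * f x \<partial>std_normal) = (\<integral>x. f' x \<partial>std_normal)"
proof -
  let ?n = "std_normal_density"
  have cf: "continuous_on UNIV f"
    using f by (auto intro!: continuous_at_imp_continuous_on DERIV_isCont)
  have [measurable]: "f \<in> borel_measurable borel" "f' \<in> borel_measurable borel"
    using cf f' by (auto intro: borel_measurable_continuous_onI)
  have dn: "(?n has_real_derivative - x * ?n x) (at x)" for x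
    unfolding normal_density_def
    by (auto intro!: derivative_eq_intros simp: field_simps)
  have i1: "integrable lborel (\<lambda>x. ?n x * f' x)"
  proof (rule Bochner_Integration.integrable_bound)
    show "integrable lborel (\<lambda>x. ?n x * D)"
      by (auto intro!: integrable_normal_density)
  qed (auto simp: abs_mult intro!: AE_I2 mult_left_mono order_trans[OF D])
  have i2: "integrable lborel (\<lambda>x. ?n x * (x * f x))"
  proof (rule Bochner_Integration.integrable_bound)
    show "integrable lborel (\<lambda>x. C * (?n x * \<bar>x\<bar>^1))"
      by (intro integrable_mult_right integrable_std_normal_moment_abs)
    show "AE x in lborel. norm (?n x * (x * f x)) \<le> norm (C * (?n x * \<bar>x\<bar> ^ 1))"
    proof (rule AE_I2)
      fix x :: real
      have "C \<ge> 0" using C[of 0] by simp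
      have "?n x * \<bar>x\<bar> * \<bar>f x\<bar> \<le> ?n x * \<bar>x\<bar> * C" using C by (intro mult_left_mono) auto
      then show "norm (?n x * (x * f x)) \<le> norm (C * (?n x * \<bar>x\<bar> ^ 1))"
        using \<open>C \<ge> 0\<close> by (simp add: abs_mult mult_ac)
    qed
  qed auto
  define F where "F x = ?n x * f x" for x
  define G where "G x = ?n x * f' x - ?n x * (x * f x)" for x
  have lim: "(F \<longlongrightarrow> 0) at_top" "(F \<longlongrightarrow> 0) at_bot"
  proof -
    have n: "(?n \<longlongrightarrow> 0) at_top" "(?n \<longlongrightarrow> 0) at_bot"
      unfolding normal_density_def by real_asymp+
    have "norm (F x) \<le> norm (?n x) * C" for x
      using C by (auto simp: F_def abs_mult intro!: mult_left_mono)
    then show "(F \<longlongrightarrow> 0) at_top" "(F \<longlongrightarrow> 0) at_bot"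
      using tendsto_0_le[OF n(1), of F C] tendsto_0_le[OF n(2), of F C] by simp_all
  qed
  have "(LBINT x=-\<infinity>..\<infinity>. G x) = 0 - 0"
  proof (rule interval_integral_FTC_integrable)
    show "(F has_vector_derivative G x) (at x)" for x
      unfolding F_def G_def has_real_derivative_iff_has_vector_derivative[symmetric]
      by (auto intro!: derivative_eq_intros f dn)
    show "isCont G x" for x
    proof -
      have "continuous_on UNIV ?n"
        using dn by (auto intro!: continuous_at_imp_continuous_on DERIV_isCont)
      then have "continuous_on UNIV G"
        unfolding G_def by (intro continuous_on_diff continuous_on_mult f' cf continuous_on_id)
      then show ?thesis by (simp add: continuous_on_eq_continuous_at)
    qed
    show "set_integrable lborel (einterval (-\<infinity>) \<infinity>) G"
      using i1 i2 by (auto simp: G_def set_integrable_def)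
    show "((F \<circ> real_of_ereal) \<longlongrightarrow> 0) (at_right (-\<infinity>))"
      using lim by (simp add: comp_def at_right_MInf filterlim_filtermap)
    show "((F \<circ> real_of_ereal) \<longlongrightarrow> 0) (at_left \<infinity>)"
      using lim by (simp add: comp_def at_left_PInf filterlim_filtermap)
  qed auto
  then have "(\<integral>x. G x \<partial>lborel) = 0"
    by (simp add: interval_lebesgue_integral_def set_lebesgue_integral_def)
  then have "(\<integral>x. ?n x * f' x \<partial>lborel) = (\<integral>x. ?n x * (x * f x) \<partial>lborel)"
    unfolding G_def using i1 i2 by simp
  then show ?thesis
    by (simp add: integral_density)
qed

lemma measurable_gauss_prod_component[measurable]:
  "(\<lambda>w. w k) \<in> borel_measurable (gauss_prod :: ('k::finite \<Rightarrow> real) measure)"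
proof -
  have "(\<lambda>w::'k \<Rightarrow> real. w k) \<in> gauss_prod \<rightarrow>\<^sub>M std_normal" by (rule measurable_component_singleton) simp
  then show ?thesis by simp
qed

lemma integrable_gauss_prod_component:
  "integrable (gauss_prod :: ('k::finite \<Rightarrow> real) measure) (\<lambda>w. \<bar>w k\<bar>)"
proof -
  have "distr gauss_prod std_normal (\<lambda>w::'k\<Rightarrow>real. w k) = std_normal"
    by (rule distr_PiM_component) (auto intro: prob_space_std_normal)
  moreover have "(\<lambda>w::'k\<Rightarrow>real. w k) \<in> gauss_prod \<rightarrow>\<^sub>M std_normal"
    by (rule measurable_component_singleton) simp
  note integrable_distr[OF this, of "\<lambda>x. \<bar>x\<bar>"]
  ultimately show ?thesis
    using integrable_std_normal_abs by simp
qed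

text \<open>Fubini isolates coordinate \<open>k\<close>; with the other coordinates frozen, the
  inner integral is the one-dimensional identity.\<close>

lemma gauss_prod_stein:
  fixes F F' :: "('k::finite \<Rightarrow> real) \<Rightarrow> real"
  assumes [measurable]: "F \<in> borel_measurable gauss_prod" "F' \<in> borel_measurable gauss_prod"
    and f: "\<And>w r. ((\<lambda>r. F (w(k := r))) has_real_derivative F' (w(k := r))) (at r)"
    and f': "\<And>w. continuous_on UNIV (\<lambda>r. F' (w(k := r)))"
    and C: "\<And>x. \<bar>F x\<bar> \<le> C" and D: "\<And>x. \<bar>F' x\<bar> \<le> D"
  shows "(\<integral>w. w k * F w \<partial>gauss_prod) = (\<integral>w. F' w \<partial>gauss_prod)"
proof -
  interpret prob_space "gauss_prod :: ('k \<Rightarrow> real) measure" by (rule prob_space_gauss_prod)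
  interpret product_sigma_finite "\<lambda>_::'k. std_normal"
    by (intro product_sigma_finite.intro prob_space_imp_sigma_finite prob_space_std_normal)
  have U: "UNIV = insert k (UNIV - {k})" by auto
  have i1: "integrable gauss_prod (\<lambda>w. w k * F w)"
  proof (rule Bochner_Integration.integrable_bound)
    show "integrable gauss_prod (\<lambda>w::'k \<Rightarrow> real. C * \<bar>w k\<bar>)"
      by (intro integrable_mult_right integrable_gauss_prod_component)
    have "C \<ge> 0" using C[of undefined] by simp
    then show "AE w in gauss_prod. norm (w k * F w) \<le> norm (C * \<bar>w k\<bar>)"
      using C by (auto simp: abs_mult mult.commute[of C] intro!: AE_I2 mult_left_mono)
    show "(\<lambda>w. w k * F w) \<in> borel_measurable gauss_prod"
      by (intro borel_measurable_times measurable_compose[OF measurable_component_singleton]) auto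
  qed
  have i2: "integrable gauss_prod F'"
    by (rule integrable_const_bound[where B = D]) (use D in auto)
  have "(\<integral>w. w k * F w \<partial>gauss_prod) =
    (\<integral>w. (\<integral>r. r * F (w(k := r)) \<partial>std_normal) \<partial>Pi\<^sub>M (UNIV - {k}) (\<lambda>_. std_normal))"
    by (subst U, subst product_integral_insert) (use i1 U in auto)
  also have "\<dots> = (\<integral>w. (\<integral>r. F' (w(k := r)) \<partial>std_normal) \<partial>Pi\<^sub>M (UNIV - {k}) (\<lambda>_. std_normal))"
    by (intro Bochner_Integration.integral_cong refl std_normal_stein[OF f f' C D])
  also have "\<dots> = (\<integral>w. F' w \<partial>gauss_prod)"
    by (subst (2) U, subst product_integral_insert) (use i2 U in auto)
  finally show ?thesis .
qed

section \<open>Differentiation under the integral and Gaussian interpolation\<close>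

lemma has_real_derivative_integral_dominated:
  fixes f f' :: "real \<Rightarrow> 'a \<Rightarrow> real"
  assumes f: "\<And>t w. ((\<lambda>t. f t w) has_real_derivative f' t w) (at t)"
    and int: "\<And>t. integrable M (f t)"
    and meas: "\<And>t. f' t \<in> borel_measurable M"
    and B: "integrable M B" "\<And>t w. \<bar>f' t w\<bar> \<le> B w"
  shows "((\<lambda>t. \<integral>w. f t w \<partial>M) has_real_derivative (\<integral>w. f' t w \<partial>M)) (at t)"
  unfolding DERIV_def tendsto_at_iff_sequentially
proof (intro allI impI)
  \<comment> \<open>Differentiability is tested along an arbitrary null sequence of increments, so
    that dominated convergence for sequences applies.\<close>
  fix h :: "nat \<Rightarrow> real"
  assume h0: "\<forall>i. h i \<in> UNIV - {0}" and h: "h \<longlonglongrightarrow> 0"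
  have bound: "\<bar>(f (t + h n) w - f t w) / h n\<bar> \<le> B w" for n w
  proof -
    \<comment> \<open>\<open>B\<close> bounds \<open>f'\<close> for all \<open>t\<close> at once, so
      any intermediate point from the mean value theorem gives the dominating bound.\<close>
    obtain s where "f (t + h n) w - f t w = h n * f' s w"
    proof (cases "h n > 0")
      case True
      then obtain s where "f (t + h n) w - f t w = (t + h n - t) * f' s w"
        using MVT2[of t "t + h n" "\<lambda>t. f t w" "\<lambda>t. f' t w"] f by auto
      then show ?thesis using that[of s] by simp
    next
      case False
      then have "h n < 0" using h0[rule_format, of n] by auto
      then obtain s where "f t w - f (t + h n) w = (t - (t + h n)) * f' s w"
        using MVT2[of "t + h n" t "\<lambda>t. f t w" "\<lambda>t. f' t w"] f by auto
      then show ?thesis using that[of s] by (simp add: algebra_simps)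
    qed
    then show ?thesis using B(2) h0[rule_format, of n] by simp
  qed
  have "(\<lambda>n. \<integral>w. (f (t + h n) w - f t w) / h n \<partial>M) \<longlonglongrightarrow> (\<integral>w. f' t w \<partial>M)"
  proof (rule integral_dominated_convergence[where w = B])
    show "(\<lambda>w. (f (t + h n) w - f t w) / h n) \<in> borel_measurable M" for n
      by (intro borel_measurable_divide borel_measurable_diff borel_measurable_const
          borel_measurable_integrable int)
    show "AE w in M. (\<lambda>n. (f (t + h n) w - f t w) / h n) \<longlonglongrightarrow> f' t w"
    proof (rule AE_I2)
      fix w
      show "(\<lambda>n. (f (t + h n) w - f t w) / h n) \<longlonglongrightarrow> f' t w"
        using f[of w t] h0 h unfolding DERIV_def tendsto_at_iff_sequentially comp_def by blast
    qed
  qed (use meas B bound in auto)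
  then show "((\<lambda>h. ((\<integral>w. f (t + h) w \<partial>M) - (\<integral>w. f t w \<partial>M)) / h) \<circ> h) \<longlonglongrightarrow> (\<integral>w. f' t w \<partial>M)"
    by (simp add: comp_def int)
qed

text \<open>The expectation of \<open>F\<close> along
  \<open>cos t * \<alpha> + sin t * \<beta>\<close> is nondecreasing on the quarter circle:
  integration by parts writes its derivative as \<open>sin t * cos t\<close> times a sum of
  covariance differences against expected second derivatives, and \<open>sgn\<close> makes each
  summand nonnegative. One vector \<open>w\<close> drives both families; orthogonality of their
  coefficients stands for independence. Regularity of \<open>F\<close> is phrased along arbitrary
  curves, so that only the coordinates in \<open>I\<close> are constrained.\<close>

lemma gaussian_interpolation:
  fixes F :: "('i \<Rightarrow> real) \<Rightarrow> real"
    and F1 :: "'i \<Rightarrow> ('i \<Rightarrow> real) \<Rightarrow> real" and F2 :: "'i \<Rightarrow> 'i \<Rightarrow> ('i \<Rightarrow> real) \<Rightarrow> real"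
    and \<alpha> \<beta> :: "'i \<Rightarrow> 'k::finite \<Rightarrow> real" and M :: "('k \<Rightarrow> real) measure"
  defines M: "M \<equiv> (gauss_prod :: ('k \<Rightarrow> real) measure)"
  assumes deriv_F: "\<And>z z' r. (\<And>i. i \<in> I \<Longrightarrow> ((\<lambda>r. z r i) has_real_derivative z' i) (at r)) \<Longrightarrow>
      ((\<lambda>r. F (z r)) has_real_derivative (\<Sum>i\<in>I. F1 i (z r) * z' i)) (at r)"
    and deriv_F1: "\<And>z z' r i. i \<in> I \<Longrightarrow> (\<And>i. i \<in> I \<Longrightarrow> ((\<lambda>r. z r i) has_real_derivative z' i) (at r)) \<Longrightarrow>
      ((\<lambda>r. F1 i (z r)) has_real_derivative (\<Sum>j\<in>I. F2 i j (z r) * z' j)) (at r)"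
    and cont_F2: "\<And>z i j. i \<in> I \<Longrightarrow> j \<in> I \<Longrightarrow> (\<And>i. i \<in> I \<Longrightarrow> continuous_on UNIV (\<lambda>r. z r i)) \<Longrightarrow>
      continuous_on UNIV (\<lambda>r::real. F2 i j (z r))"
    and bound: "\<And>x. \<bar>F x\<bar> \<le> C" "\<And>i x. i \<in> I \<Longrightarrow> \<bar>F1 i x\<bar> \<le> C"
      "\<And>i j x. i \<in> I \<Longrightarrow> j \<in> I \<Longrightarrow> \<bar>F2 i j x\<bar> \<le> C"
    and meas_F: "\<And>z. (\<And>i. i \<in> I \<Longrightarrow> (\<lambda>w. z w i) \<in> borel_measurable M) \<Longrightarrow>
      (\<lambda>w. F (z w)) \<in> borel_measurable M"
    and meas_F1: "\<And>i z. i \<in> I \<Longrightarrow> (\<And>i. i \<in> I \<Longrightarrow> (\<lambda>w. z w i) \<in> borel_measurable M) \<Longrightarrow>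
      (\<lambda>w. F1 i (z w)) \<in> borel_measurable M"
    and meas_F2: "\<And>i j z. i \<in> I \<Longrightarrow> j \<in> I \<Longrightarrow> (\<And>i. i \<in> I \<Longrightarrow> (\<lambda>w. z w i) \<in> borel_measurable M) \<Longrightarrow>
      (\<lambda>w. F2 i j (z w)) \<in> borel_measurable M"
    and orth: "\<And>i j. i \<in> I \<Longrightarrow> j \<in> I \<Longrightarrow> (\<Sum>k\<in>UNIV. \<alpha> i k * \<beta> j k) = 0"
    and sgn: "\<And>i j x. i \<in> I \<Longrightarrow> j \<in> I \<Longrightarrow>
      0 \<le> ((\<Sum>k\<in>UNIV. \<beta> i k * \<beta> j k) - (\<Sum>k\<in>UNIV. \<alpha> i k * \<alpha> j k)) * F2 i j x"
  shows "(\<integral>w. F (\<lambda>i. \<Sum>k\<in>UNIV. \<alpha> i k * w k) \<partial>M) \<le> (\<integral>w. F (\<lambda>i. \<Sum>k\<in>UNIV. \<beta> i k * w k) \<partial>M)"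
proof -
  interpret prob_space M unfolding M by (rule prob_space_gauss_prod)
  define c where "c t i k = cos t * \<alpha> i k + sin t * \<beta> i k" for t i k
  define c' where "c' t i k = - sin t * \<alpha> i k + cos t * \<beta> i k" for t i k
  define Z where "Z t w i = (\<Sum>k\<in>UNIV. c t i k * w k)" for t and w :: "'k \<Rightarrow> real" and i
  have comp: "(\<lambda>w. w k) \<in> borel_measurable M" for k
    unfolding M by (rule measurable_gauss_prod_component)
  have Zm: "(\<lambda>w. Z t w i) \<in> borel_measurable M" for t i unfolding Z_def by (intro borel_measurable_sum borel_measurable_times borel_measurable_const comp)
  have dc: "((\<lambda>t. Z t w i) has_real_derivative (\<Sum>k\<in>UNIV. c' t i k * w k)) (at t)" for t w i
    unfolding Z_def c_def c'_def by (auto intro!: derivative_eq_intros simp: algebra_simps)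
  have dk: "((\<lambda>r. Z t (w(k := r)) i) has_real_derivative c t i k) (at r)" for t w i k r
  proof -
    have "Z t (w(k := r)) i = c t i k * r + (\<Sum>l\<in>UNIV - {k}. c t i l * w l)" for r
      unfolding Z_def by (subst sum.remove[of _ k]) auto
    then show ?thesis by (auto intro!: derivative_eq_intros)
  qed
  define D where "D t w = (\<Sum>i\<in>I. F1 i (Z t w) * (\<Sum>k\<in>UNIV. c' t i k * w k))" for t w
  define H where "H t = (\<integral>w. F (Z t w) \<partial>M)" for t
  have abs_int: "integrable M (\<lambda>w. \<bar>w k\<bar>)" for k
    unfolding M by (rule integrable_gauss_prod_component)
  have C0: "C \<ge> 0" using bound(1)[of undefined] by simp
  \<comment> \<open>A bound on the coefficients of the derivative that is free of \<open>t\<close>,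
    as domination requires.\<close>
  have c'le: "\<bar>c' t i k\<bar> \<le> \<bar>\<alpha> i k\<bar> + \<bar>\<beta> i k\<bar>" for t i k
  proof -
    have "\<bar>sin t * \<alpha> i k\<bar> \<le> 1 * \<bar>\<alpha> i k\<bar>" "\<bar>cos t * \<beta> i k\<bar> \<le> 1 * \<bar>\<beta> i k\<bar>"
      unfolding abs_mult by (intro mult_right_mono; simp)+
    then show ?thesis unfolding c'_def by simp
  qed
  have H': "(H has_real_derivative (\<integral>w. D t w \<partial>M)) (at t)" for t
    unfolding H_def
  proof (rule has_real_derivative_integral_dominated)
    show "((\<lambda>t. F (Z t w)) has_real_derivative D t w) (at t)" for t w
      unfolding D_def by (rule deriv_F[OF dc])
    show "integrable M (\<lambda>w. F (Z t w))" for t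
      by (rule integrable_const_bound[where B = C]) (use bound meas_F[OF Zm] in auto)
    show "D t \<in> borel_measurable M" for t
      unfolding D_def
      by (intro borel_measurable_sum borel_measurable_times meas_F1 Zm borel_measurable_const comp)
    show "integrable M (\<lambda>w. \<Sum>i\<in>I. C * (\<Sum>k\<in>UNIV. (\<bar>\<alpha> i k\<bar> + \<bar>\<beta> i k\<bar>) * \<bar>w k\<bar>))"
      by (intro Bochner_Integration.integrable_sum integrable_mult_right abs_int)
    show "\<bar>D t w\<bar> \<le> (\<Sum>i\<in>I. C * (\<Sum>k\<in>UNIV. (\<bar>\<alpha> i k\<bar> + \<bar>\<beta> i k\<bar>) * \<bar>w k\<bar>))" for t w
      unfolding D_def
    proof (intro order_trans[OF sum_abs] sum_mono)
      fix i assume i: "i \<in> I"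
      have "\<bar>\<Sum>k\<in>UNIV. c' t i k * w k\<bar> \<le> (\<Sum>k\<in>UNIV. (\<bar>\<alpha> i k\<bar> + \<bar>\<beta> i k\<bar>) * \<bar>w k\<bar>)"
        by (intro order_trans[OF sum_abs] sum_mono) (simp add: abs_mult c'le mult_right_mono)
      then show "\<bar>F1 i (Z t w) * (\<Sum>k\<in>UNIV. c' t i k * w k)\<bar>
          \<le> C * (\<Sum>k\<in>UNIV. (\<bar>\<alpha> i k\<bar> + \<bar>\<beta> i k\<bar>) * \<bar>w k\<bar>)"
        unfolding abs_mult using bound(2)[OF i] C0 by (intro mult_mono) auto
    qed
  qed
  \<comment> \<open>Integration by parts in coordinate \<open>k\<close>: moving \<open>w k\<close>
    moves every \<open>Z t w j\<close> at rate \<open>c t j k\<close>, so the chain rule sums over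
    all \<open>j\<close>.\<close>
  have stein: "(\<integral>w. w k * F1 i (Z t w) \<partial>M) = (\<Sum>j\<in>I. c t j k * (\<integral>w. F2 i j (Z t w) \<partial>M))"
    if i: "i \<in> I" for i k t
  proof -
    have int2: "integrable M (\<lambda>w. F2 i j (Z t w))" if "j \<in> I" for j
      by (rule integrable_const_bound[where B = C]) (use bound i that meas_F2[OF _ _ Zm] in auto)
    have "(\<integral>w. w k * F1 i (Z t w) \<partial>M) = (\<integral>w. (\<Sum>j\<in>I. F2 i j (Z t w) * c t j k) \<partial>M)"
      unfolding M
    proof (rule gauss_prod_stein)
      show "(\<lambda>w. F1 i (Z t w)) \<in> borel_measurable gauss_prod"
        using meas_F1[OF i Zm] unfolding M .
      show "(\<lambda>w. \<Sum>j\<in>I. F2 i j (Z t w) * c t j k) \<in> borel_measurable gauss_prod"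
        unfolding M[symmetric]
        by (intro borel_measurable_sum borel_measurable_times meas_F2 i Zm borel_measurable_const)
      show "((\<lambda>r. F1 i (Z t (w(k := r)))) has_real_derivative
          (\<Sum>j\<in>I. F2 i j (Z t (w(k := r))) * c t j k)) (at r)" for w r
        by (rule deriv_F1[OF i dk])
      show "continuous_on UNIV (\<lambda>r. \<Sum>j\<in>I. F2 i j (Z t (w(k := r))) * c t j k)" for w
        by (intro continuous_on_sum continuous_on_mult continuous_on_const cont_F2 i)
          (auto intro!: continuous_at_imp_continuous_on DERIV_isCont[OF dk])
      show "\<bar>F1 i (Z t w)\<bar> \<le> C" for w by (rule bound(2)[OF i])
      show "\<bar>\<Sum>j\<in>I. F2 i j (Z t w) * c t j k\<bar> \<le> (\<Sum>j\<in>I. C * \<bar>c t j k\<bar>)" for w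
        by (intro order_trans[OF sum_abs] sum_mono) (simp add: abs_mult bound(3) i mult_right_mono)
    qed
    also have "\<dots> = (\<Sum>j\<in>I. c t j k * (\<integral>w. F2 i j (Z t w) \<partial>M))"
      using int2 by (subst Bochner_Integration.integral_sum) (auto simp: mult.commute)
    finally show ?thesis .
  qed
  have ED: "(\<integral>w. D t w \<partial>M) = (\<Sum>i\<in>I. \<Sum>j\<in>I. (\<Sum>k\<in>UNIV. c' t i k * c t j k) * (\<integral>w. F2 i j (Z t w) \<partial>M))" for t
  proof -
    have int1: "integrable M (\<lambda>w. w k * F1 i (Z t w))" if i: "i \<in> I" for i k
    proof (rule Bochner_Integration.integrable_bound)
      show "integrable M (\<lambda>w. C * \<bar>w k\<bar>)" by (intro integrable_mult_right abs_int)
      show "(\<lambda>w. w k * F1 i (Z t w)) \<in> borel_measurable M"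
        by (intro borel_measurable_times meas_F1 i Zm comp)
      show "AE w in M. norm (w k * F1 i (Z t w)) \<le> norm (C * \<bar>w k\<bar>)"
        using bound(2)[OF i] C0
        by (auto simp: abs_mult mult.commute[of C] intro!: AE_I2 mult_left_mono)
    qed
    have "D t = (\<lambda>w. \<Sum>i\<in>I. \<Sum>k\<in>UNIV. c' t i k * (w k * F1 i (Z t w)))"
      unfolding D_def by (simp add: fun_eq_iff sum_distrib_left mult_ac)
    then have "(\<integral>w. D t w \<partial>M) = (\<Sum>i\<in>I. \<Sum>k\<in>UNIV. c' t i k * (\<integral>w. w k * F1 i (Z t w) \<partial>M))"
      using int1 by simp
    also have "\<dots> = (\<Sum>i\<in>I. \<Sum>k\<in>UNIV. \<Sum>j\<in>I. (c' t i k * c t j k) * (\<integral>w. F2 i j (Z t w) \<partial>M))"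
      by (intro sum.cong refl) (simp add: stein sum_distrib_left mult.assoc)
    also have "\<dots> = (\<Sum>i\<in>I. \<Sum>j\<in>I. \<Sum>k\<in>UNIV. (c' t i k * c t j k) * (\<integral>w. F2 i j (Z t w) \<partial>M))"
      by (intro sum.cong refl sum.swap)
    finally show ?thesis by (simp add: sum_distrib_right)
  qed
  \<comment> \<open>The mixed products, weighted by squares of sine and cosine, vanish by
    \<open>orth\<close>; only the difference of the two covariances survives.\<close>
  have cc: "(\<Sum>k\<in>UNIV. c' t i k * c t j k) =
      sin t * cos t * ((\<Sum>k\<in>UNIV. \<beta> i k * \<beta> j k) - (\<Sum>k\<in>UNIV. \<alpha> i k * \<alpha> j k))"
    if "i \<in> I" "j \<in> I" for t i j
  proof -
    have "c' t i k * c t j k = sin t * cos t * (\<beta> i k * \<beta> j k) - sin t * cos t * (\<alpha> i k * \<alpha> j k)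
        - (sin t)\<^sup>2 * (\<alpha> i k * \<beta> j k) + (cos t)\<^sup>2 * (\<alpha> j k * \<beta> i k)" for k
      by (simp add: c_def c'_def algebra_simps power2_eq_square)
    then show ?thesis
      using orth[of i j] orth[of j i] that
      by (simp add: sum.distrib sum_subtractf sum_distrib_left[symmetric] right_diff_distrib)
  qed
  \<comment> \<open>\<open>H 0\<close> is the \<alpha> side and \<open>H (pi / 2)\<close> the
    \<beta> side; \<open>sin t * cos t\<close> is nonnegative between them.\<close>
  have "H 0 \<le> H (pi / 2)"
  proof (rule DERIV_nonneg_imp_nondecreasing[where f = H])
    fix t :: real assume t: "0 \<le> t" "t \<le> pi / 2"
    have sc: "0 \<le> sin t * cos t" using t by (intro mult_nonneg_nonneg sin_ge_zero cos_ge_zero) auto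
    have "0 \<le> (\<integral>w. D t w \<partial>M)"
      unfolding ED
    proof (intro sum_nonneg)
      fix i j assume ij: "i \<in> I" "j \<in> I"
      let ?d = "(\<Sum>k\<in>UNIV. \<beta> i k * \<beta> j k) - (\<Sum>k\<in>UNIV. \<alpha> i k * \<alpha> j k)"
      \<comment> \<open>The covariance difference is moved under the integral because
        \<open>sgn\<close> is a pointwise statement.\<close>
      have "0 \<le> sin t * cos t * (\<integral>w. ?d * F2 i j (Z t w) \<partial>M)"
        by (intro mult_nonneg_nonneg sc integral_nonneg_AE AE_I2 sgn ij)
      then show "0 \<le> (\<Sum>k\<in>UNIV. c' t i k * c t j k) * (\<integral>w. F2 i j (Z t w) \<partial>M)"
        unfolding cc[OF ij] by (simp add: mult.assoc)
    qed
    with H' show "\<exists>y. (H has_real_derivative y) (at t) \<and> 0 \<le> y" by blast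
  qed simp
  then show ?thesis by (simp add: H_def Z_def[abs_def] c_def)
qed

subsection \<open>Gordon's inequality\<close>

text \<open>The decreasing variant of the sigmoid: \<open>logistic (n * y)\<close> approaches the
  indicator of \<open>y < 0\<close> as \<open>n\<close> grows, except at
  \<open>y = 0\<close>.\<close>

definition logistic :: "real \<Rightarrow> real" where "logistic x = 1 / (1 + exp x)"

lemma logistic_bounds: "0 < logistic x" "logistic x < 1"
  unfolding logistic_def using exp_gt_zero[of x] by (simp_all add: add_pos_pos divide_simps)

lemma DERIV_logistic:
  assumes "(f has_real_derivative f') (at x)"
  shows "((\<lambda>x. logistic (f x)) has_real_derivative
    - (logistic (f x) * (1 - logistic (f x))) * f') (at x)"
proof -
  have "1 + exp (f x) \<noteq> 0" using exp_gt_zero[of "f x"] by (simp add: add_pos_pos less_imp_neq[symmetric])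
  then show ?thesis
    unfolding logistic_def
    by (auto intro!: derivative_eq_intros assms) (simp add: field_simps power2_eq_square)
qed

lemma continuous_on_logistic: "continuous_on UNIV logistic"
  using DERIV_logistic[OF DERIV_ident]
  by (auto intro!: continuous_at_imp_continuous_on DERIV_isCont)

text \<open>
  With \<open>q = q' - t\<close>, the test function \<open>F\<close> below is a smooth version of the indicator of
  \<open>\<forall>v\<in>V. \<exists>u\<in>U. x (v, u) + q' (v, u) > t\<close>, with sharpness \<open>n\<close>.
\<close>

locale gordon_test =
  fixes V :: "'o set" and U :: "'i set" and q :: "'o \<times> 'i \<Rightarrow> real" and n :: real
  assumes finite_V[simp]: "finite V" and finite_U[simp]: "finite U" and n: "n > 0"
begin

definition s where "s i x = logistic (n * (x i + q i))" for x :: "'o \<times> 'i \<Rightarrow> real"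
text \<open>Minus the derivative of \<open>s i\<close> in coordinate \<open>i\<close>, with the sign
  chosen to make it nonnegative; \<open>dds\<close> is the derivative of \<open>ds\<close>.\<close>

definition ds where "ds i x = n * (s i x * (1 - s i x))" for x :: "'o \<times> 'i \<Rightarrow> real"
definition dds where "dds i x = - (n * (ds i x * (1 - 2 * s i x)))" for x :: "'o \<times> 'i \<Rightarrow> real"
text \<open>The product is a smooth form of "every \<open>u\<close> stays below the threshold", so
  \<open>T v\<close> approximates "some \<open>u\<close> exceeds it in row
  \<open>v\<close>".\<close>

definition T where "T v x = 1 - (\<Prod>u\<in>U. s (v, u) x)" for x :: "'o \<times> 'i \<Rightarrow> real"

text \<open>\<open>E v u\<close> is the partial derivative of \<open>T v\<close> in the coordinate \<open>(v, u)\<close>, and \<open>G v u u'\<close> that of \<open>E v u\<close> in \<open>(v, u')\<close>.\<close>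

definition E where "E v u x = ds (v, u) x * (\<Prod>u'\<in>U - {u}. s (v, u') x)" for x :: "'o \<times> 'i \<Rightarrow> real"
definition G where "G v u u' x = (if u = u' then dds (v, u) x * (\<Prod>u'\<in>U - {u}. s (v, u') x)
  else - (ds (v, u) x * ds (v, u') x * (\<Prod>u''\<in>U - {u} - {u'}. s (v, u'') x)))" for x :: "'o \<times> 'i \<Rightarrow> real"
definition F where "F x = (\<Prod>v\<in>V. T v x)" for x :: "'o \<times> 'i \<Rightarrow> real"
definition F1 where "F1 i x = (case i of (v, u) \<Rightarrow> E v u x * (\<Prod>v'\<in>V - {v}. T v' x))"
text \<open>The second partial derivatives of \<open>F\<close>. Each \<open>T v\<close> depends on
  its own row only, so derivatives in different rows fall on different factors, while two
  derivatives in one row hit the same factor twice.\<close>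

definition F2 where "F2 i j x = (case i of (v, u) \<Rightarrow> case j of (v', u') \<Rightarrow>
  if v = v' then G v u u' x * (\<Prod>v'\<in>V - {v}. T v' x)
  else E v u x * (E v' u' x * (\<Prod>v''\<in>V - {v} - {v'}. T v'' x)))"

section \<open>Bounds, signs and regularity of the test function\<close>

lemma s_bounds: "0 < s i x" "s i x < 1" "0 \<le> s i x" "s i x \<le> 1"
  using logistic_bounds[of "n * (x i + q i)"] by (auto simp: s_def)

lemma prod_s_bounds: "0 \<le> (\<Prod>u\<in>U'. s (f u) x)" "(\<Prod>u\<in>U'. s (f u) x) \<le> 1"
  by (auto intro!: prod_nonneg prod_le_1 s_bounds)

lemma T_bounds: "0 \<le> T v x" "T v x \<le> 1"
  using prod_s_bounds[of "Pair v" x U] by (auto simp: T_def)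

lemma prod_T_bounds: "0 \<le> (\<Prod>v\<in>V'. T v x)" "(\<Prod>v\<in>V'. T v x) \<le> 1"
  by (auto intro!: prod_nonneg prod_le_1 T_bounds)

lemma ds_bounds: "0 \<le> ds i x" "ds i x \<le> n"
proof -
  have "s i x * (1 - s i x) \<le> 1 * 1" using s_bounds[of i x] by (intro mult_mono) auto
  then show "ds i x \<le> n" unfolding ds_def using n by (simp add: mult_left_le)
  show "0 \<le> ds i x" using n s_bounds[of i x] by (simp add: ds_def)
qed

lemma dds_bound: "\<bar>dds i x\<bar> \<le> n * n"
proof -
  have "\<bar>1 - 2 * s i x\<bar> \<le> 1" using s_bounds[of i x] by (auto simp: abs_if)
  then have "ds i x * \<bar>1 - 2 * s i x\<bar> \<le> n * 1" using ds_bounds[of i x] by (intro mult_mono) auto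
  then show ?thesis unfolding dds_def using n ds_bounds[of i x] by (simp add: abs_mult)
qed

lemma E_bounds: "0 \<le> E v u x" "E v u x \<le> n"
proof -
  show "0 \<le> E v u x" unfolding E_def by (intro mult_nonneg_nonneg ds_bounds prod_s_bounds)
  have "E v u x \<le> n * 1" unfolding E_def
    by (intro mult_mono ds_bounds prod_s_bounds) (use n in auto)
  then show "E v u x \<le> n" by simp
qed

lemma G_bound: "\<bar>G v u u' x\<bar> \<le> n * n"
proof (cases "u = u'")
  case True
  have "\<bar>dds (v, u) x\<bar> * \<bar>\<Prod>u'\<in>U - {u}. s (v, u') x\<bar> \<le> n * n * 1"
    by (intro mult_mono dds_bound) (use prod_s_bounds[of "Pair v" x "U - {u}"] n in auto)
  with True show ?thesis by (simp add: G_def abs_mult)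
next
  case False
  have "ds (v, u) x * ds (v, u') x * (\<Prod>u''\<in>U - {u} - {u'}. s (v, u'') x) \<le> n * n * 1"
    by (intro mult_mono ds_bounds prod_s_bounds mult_nonneg_nonneg) (use n in auto)
  moreover have "0 \<le> ds (v, u) x * ds (v, u') x * (\<Prod>u''\<in>U - {u} - {u'}. s (v, u'') x)"
    by (intro ds_bounds prod_s_bounds mult_nonneg_nonneg)
  ultimately show ?thesis using False by (simp add: G_def)
qed

lemma F_bounds: "0 \<le> F x" "F x \<le> 1"
  unfolding F_def by (rule prod_T_bounds)+

lemma F1_bound: "\<bar>F1 i x\<bar> \<le> n"
proof (cases i)
  case (Pair v u)
  have "E v u x * (\<Prod>v'\<in>V - {v}. T v' x) \<le> n * 1"
    by (intro mult_mono E_bounds prod_T_bounds) (use n in auto)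
  moreover have "0 \<le> E v u x * (\<Prod>v'\<in>V - {v}. T v' x)"
    by (intro mult_nonneg_nonneg E_bounds prod_T_bounds)
  ultimately show ?thesis using Pair by (simp add: F1_def)
qed

text \<open>Across rows the mixed derivative is a product of the nonnegative \<open>E\<close> and
  \<open>T\<close>. This is the sign that Gordon's comparison needs; inside a row the sign is left
  open, and equal covariances make up for it.\<close>

lemma F2_nonneg: "fst i \<noteq> fst j \<Longrightarrow> 0 \<le> F2 i j x"
  by (cases i; cases j) (auto simp: F2_def intro!: mult_nonneg_nonneg E_bounds prod_T_bounds)

lemma F2_bound: "\<bar>F2 i j x\<bar> \<le> n * n"
proof (cases i, cases j)
  fix v u v' u' assume ij: "i = (v, u)" "j = (v', u')"
  show ?thesis
  proof (cases "v = v'")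
    case True
    have "\<bar>G v u u' x\<bar> * \<bar>\<Prod>v'\<in>V - {v}. T v' x\<bar> \<le> n * n * 1"
      by (intro mult_mono G_bound) (use prod_T_bounds[of x "V - {v}"] n in auto)
    then show ?thesis using True ij by (simp add: F2_def abs_mult)
  next
    case False
    have "E v u x * (E v' u' x * (\<Prod>v''\<in>V - {v} - {v'}. T v'' x)) \<le> n * (n * 1)"
      by (intro mult_mono E_bounds prod_T_bounds mult_nonneg_nonneg) (use n in auto)
    then show ?thesis using F2_nonneg[of i j x] ij False by (simp add: F2_def)
  qed
qed

lemma continuous_on_s:
  "continuous_on A (\<lambda>r. z r i) \<Longrightarrow> continuous_on A (\<lambda>r. s i (z r))"
  unfolding s_def
  by (intro continuous_on_compose2[OF continuous_on_logistic] continuous_intros) auto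

lemma measurable_s:
  "(\<lambda>w. z w i) \<in> borel_measurable M \<Longrightarrow> (\<lambda>w. s i (z w)) \<in> borel_measurable M"
  unfolding s_def
  by (intro measurable_compose[OF _ borel_measurable_continuous_onI[OF continuous_on_logistic]]
      borel_measurable_times borel_measurable_add borel_measurable_const)

lemma continuous_on_F2:
  assumes "\<And>i. i \<in> V \<times> U \<Longrightarrow> continuous_on A (\<lambda>r. z r i)" "i \<in> V \<times> U" "j \<in> V \<times> U"
  shows "continuous_on A (\<lambda>r. F2 i j (z r))"
proof -
  have s: "continuous_on A (\<lambda>r. s (v, u) (z r))" if "v \<in> V" "u \<in> U" for u v
    by (rule continuous_on_s) (use assms that in auto)
  show ?thesis
    using assms(2,3) unfolding F2_def G_def E_def T_def dds_def ds_def
    by (cases "fst i = fst j"; cases "snd i = snd j") (auto intro!: continuous_intros s)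
qed

lemma measurable_F:
  assumes "\<And>i. i \<in> V \<times> U \<Longrightarrow> (\<lambda>w. z w i) \<in> borel_measurable M"
  shows "(\<lambda>w. F (z w)) \<in> borel_measurable M"
    and "i \<in> V \<times> U \<Longrightarrow> (\<lambda>w. F1 i (z w)) \<in> borel_measurable M"
    and "i \<in> V \<times> U \<Longrightarrow> j \<in> V \<times> U \<Longrightarrow> (\<lambda>w. F2 i j (z w)) \<in> borel_measurable M"
proof -
  have s: "(\<lambda>w. s (v, u) (z w)) \<in> borel_measurable M" if "v \<in> V" "u \<in> U" for u v
    by (rule measurable_s) (use assms that in auto)
  show "(\<lambda>w. F (z w)) \<in> borel_measurable M"
    unfolding F_def T_def
    by (auto intro!: borel_measurable_prod borel_measurable_diff s)
  show "i \<in> V \<times> U \<Longrightarrow> (\<lambda>w. F1 i (z w)) \<in> borel_measurable M"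
    unfolding F1_def E_def T_def ds_def
    by (auto intro!: borel_measurable_prod borel_measurable_diff borel_measurable_times s)
  show "i \<in> V \<times> U \<Longrightarrow> j \<in> V \<times> U \<Longrightarrow> (\<lambda>w. F2 i j (z w)) \<in> borel_measurable M"
    unfolding F2_def G_def E_def T_def dds_def ds_def
    by (cases "fst i = fst j"; cases "snd i = snd j")
      (auto intro!: borel_measurable_prod borel_measurable_diff borel_measurable_times borel_measurable_uminus s)
qed

section \<open>Chain rule for the test function along a curve\<close>

context
  fixes z :: "real \<Rightarrow> 'o \<times> 'i \<Rightarrow> real" and z' :: "'o \<times> 'i \<Rightarrow> real" and r :: real
  assumes z: "\<And>i. i \<in> V \<times> U \<Longrightarrow> ((\<lambda>r. z r i) has_real_derivative z' i) (at r)"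
begin

lemma deriv_s:
  assumes "i \<in> V \<times> U"
  shows "((\<lambda>r. s i (z r)) has_real_derivative - ds i (z r) * z' i) (at r)"
proof -
  have "((\<lambda>r. n * (z r i + q i)) has_real_derivative n * z' i) (at r)"
    by (auto intro!: derivative_eq_intros z[OF assms])
  from DERIV_logistic[OF this] show ?thesis
    by (simp add: s_def ds_def mult_ac)
qed

lemma deriv_ds:
  assumes "i \<in> V \<times> U"
  shows "((\<lambda>r. ds i (z r)) has_real_derivative dds i (z r) * z' i) (at r)"
  unfolding ds_def[of i] dds_def
  by (rule derivative_eq_intros deriv_s[OF assms] refl)+ (simp add: ds_def algebra_simps)

lemma deriv_T:
  assumes v: "v \<in> V"
  shows "((\<lambda>r. T v (z r)) has_real_derivative (\<Sum>u\<in>U. E v u (z r) * z' (v, u))) (at r)"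
proof -
  have "((\<lambda>r. \<Prod>u\<in>U. s (v, u) (z r)) has_real_derivative
      (\<Sum>u\<in>U. (- ds (v, u) (z r) * z' (v, u)) * (\<Prod>u'\<in>U - {u}. s (v, u') (z r)))) (at r)"
    by (intro has_field_derivative_prod deriv_s) (use v in auto)
  from DERIV_diff[OF DERIV_const[of 1] this] show ?thesis
    unfolding T_def by (rule DERIV_cong) (simp add: E_def mult_ac sum_negf)
qed

lemma deriv_E:
  assumes v: "v \<in> V" and u: "u \<in> U"
  shows "((\<lambda>r. E v u (z r)) has_real_derivative (\<Sum>u'\<in>U. G v u u' (z r) * z' (v, u'))) (at r)"
proof -
  have p: "((\<lambda>r. \<Prod>u'\<in>U - {u}. s (v, u') (z r)) has_real_derivative
      (\<Sum>u'\<in>U - {u}. (- ds (v, u') (z r) * z' (v, u')) * (\<Prod>u''\<in>U - {u} - {u'}. s (v, u'') (z r)))) (at r)"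
    by (intro has_field_derivative_prod deriv_s) (use v in auto)
  have "((\<lambda>r. E v u (z r)) has_real_derivative
    dds (v, u) (z r) * z' (v, u) * (\<Prod>u'\<in>U - {u}. s (v, u') (z r)) +
    (\<Sum>u'\<in>U - {u}. (- ds (v, u') (z r) * z' (v, u')) * (\<Prod>u''\<in>U - {u} - {u'}. s (v, u'') (z r))) * ds (v, u) (z r)) (at r)"
    unfolding E_def by (rule DERIV_mult[OF deriv_ds p]) (use u v in auto)
  \<comment> \<open>The term for \<open>u\<close> itself comes from differentiating
    \<open>ds\<close>, the others from the remaining product; they match the two branches of
    \<open>G\<close>.\<close>
  also have "dds (v, u) (z r) * z' (v, u) * (\<Prod>u'\<in>U - {u}. s (v, u') (z r)) +
    (\<Sum>u'\<in>U - {u}. (- ds (v, u') (z r) * z' (v, u')) * (\<Prod>u''\<in>U - {u} - {u'}. s (v, u'') (z r))) * ds (v, u) (z r)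
    = G v u u (z r) * z' (v, u) + (\<Sum>u'\<in>U - {u}. G v u u' (z r) * z' (v, u'))"
    unfolding sum_distrib_right by (intro arg_cong2[where f="(+)"] sum.cong) (auto simp: G_def)
  also have "\<dots> = (\<Sum>u'\<in>U. G v u u' (z r) * z' (v, u'))"
    using u by (subst sum.remove[of U u]) auto
  finally show ?thesis .
qed

lemma deriv_prod_T:
  assumes "V' \<subseteq> V"
  shows "((\<lambda>r. \<Prod>v\<in>V'. T v (z r)) has_real_derivative
    (\<Sum>v\<in>V'. \<Sum>u\<in>U. E v u (z r) * (\<Prod>v'\<in>V' - {v}. T v' (z r)) * z' (v, u))) (at r)"
proof -
  have "((\<lambda>r. \<Prod>v\<in>V'. T v (z r)) has_real_derivative
    (\<Sum>v\<in>V'. (\<Sum>u\<in>U. E v u (z r) * z' (v, u)) * (\<Prod>v'\<in>V' - {v}. T v' (z r)))) (at r)"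
    by (intro has_field_derivative_prod deriv_T) (use assms in auto)
  then show ?thesis
    unfolding sum_distrib_right by (rule DERIV_cong) (intro sum.cong refl, simp add: mult_ac)
qed

lemma deriv_F: "((\<lambda>r. F (z r)) has_real_derivative (\<Sum>i\<in>V \<times> U. F1 i (z r) * z' i)) (at r)"
  using deriv_prod_T[of V] unfolding F_def F1_def by (simp add: sum.cartesian_product split_def)

lemma deriv_F1:
  assumes "i \<in> V \<times> U"
  shows "((\<lambda>r. F1 i (z r)) has_real_derivative (\<Sum>j\<in>V \<times> U. F2 i j (z r) * z' j)) (at r)"
proof -
  obtain v u where i: "i = (v, u)" and v: "v \<in> V" and u: "u \<in> U" using assms by auto
  let ?R = "\<Prod>v'\<in>V - {v}. T v' (z r)"
  \<comment> \<open>The first summand differentiates \<open>E v u\<close> within row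
    \<open>v\<close>, the second the product over the other rows; they match the two branches of
    \<open>F2\<close>.\<close>
  have "((\<lambda>r. F1 i (z r)) has_real_derivative
      (\<Sum>u'\<in>U. G v u u' (z r) * z' (v, u')) * ?R +
      (\<Sum>v'\<in>V - {v}. \<Sum>u'\<in>U. E v' u' (z r) * (\<Prod>v''\<in>V - {v} - {v'}. T v'' (z r)) * z' (v', u')) * E v u (z r)) (at r)"
    unfolding F1_def i prod.case by (rule DERIV_mult[OF deriv_E[OF v u] deriv_prod_T]) auto
  also have "(\<Sum>u'\<in>U. G v u u' (z r) * z' (v, u')) * ?R +
      (\<Sum>v'\<in>V - {v}. \<Sum>u'\<in>U. E v' u' (z r) * (\<Prod>v''\<in>V - {v} - {v'}. T v'' (z r)) * z' (v', u')) * E v u (z r)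
    = (\<Sum>u'\<in>U. F2 i (v, u') (z r) * z' (v, u')) + (\<Sum>v'\<in>V - {v}. \<Sum>u'\<in>U. F2 i (v', u') (z r) * z' (v', u'))"
    unfolding sum_distrib_right
    by (intro arg_cong2[where f="(+)"] sum.cong) (auto simp: F2_def i mult_ac)
  also have "\<dots> = (\<Sum>v'\<in>V. \<Sum>u'\<in>U. F2 i (v', u') (z r) * z' (v', u'))"
    by (rule sum.remove[OF finite_V v, symmetric])
  also have "\<dots> = (\<Sum>j\<in>V \<times> U. F2 i j (z r) * z' j)" by (simp add: sum.cartesian_product split_def)
  finally show ?thesis .
qed

end

text \<open>The sign condition of the interpolation splits by rows: inside a row \<open>same\<close>
  makes the covariance difference zero, and across rows \<open>cross\<close> and
  \<open>F2_nonneg\<close> give two nonnegative factors.\<close>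

lemma expectation_mono:
  fixes \<alpha> \<beta> :: "'o \<times> 'i \<Rightarrow> 'k::finite \<Rightarrow> real"
  assumes orth: "\<And>i j. i \<in> V \<times> U \<Longrightarrow> j \<in> V \<times> U \<Longrightarrow> (\<Sum>k\<in>UNIV. \<alpha> i k * \<beta> j k) = 0"
    and same: "\<And>v u u'. v \<in> V \<Longrightarrow> u \<in> U \<Longrightarrow> u' \<in> U \<Longrightarrow>
      (\<Sum>k\<in>UNIV. \<alpha> (v, u) k * \<alpha> (v, u') k) = (\<Sum>k\<in>UNIV. \<beta> (v, u) k * \<beta> (v, u') k)"
    and cross: "\<And>i j. i \<in> V \<times> U \<Longrightarrow> j \<in> V \<times> U \<Longrightarrow>
      (\<Sum>k\<in>UNIV. \<alpha> i k * \<alpha> j k) \<le> (\<Sum>k\<in>UNIV. \<beta> i k * \<beta> j k)"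
  shows "(\<integral>w. F (\<lambda>i. \<Sum>k\<in>UNIV. \<alpha> i k * w k) \<partial>gauss_prod)
    \<le> (\<integral>w. F (\<lambda>i. \<Sum>k\<in>UNIV. \<beta> i k * w k) \<partial>gauss_prod)"
\<comment> \<open>The constant dominates the bounds \<open>1\<close>, \<open>n\<close> and
  \<open>n * n\<close> for \<open>F\<close>, \<open>F1\<close> and \<open>F2\<close>
  simultaneously.\<close>
proof (rule gaussian_interpolation[where I = "V \<times> U" and ?F1.0 = F1 and ?F2.0 = F2 and C = "1 + n + n * n"])
  have nn: "0 \<le> n" "0 \<le> n * n" using n by auto
  show "\<bar>F x\<bar> \<le> 1 + n + n * n" for x using F_bounds[of x] nn by linarith
  show "\<bar>F1 i x\<bar> \<le> 1 + n + n * n" for i x using F1_bound[of i x] nn by linarith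
  show "\<bar>F2 i j x\<bar> \<le> 1 + n + n * n" for i j x using F2_bound[of i j x] nn by linarith
  show "0 \<le> ((\<Sum>k\<in>UNIV. \<beta> i k * \<beta> j k) - (\<Sum>k\<in>UNIV. \<alpha> i k * \<alpha> j k)) * F2 i j x"
    if "i \<in> V \<times> U" "j \<in> V \<times> U" for i j x
    using that same cross[OF that] F2_nonneg[of i j x]
    by (cases "fst i = fst j") (auto simp: mult_nonneg_nonneg)
qed (intro deriv_F deriv_F1 continuous_on_F2 measurable_F orth; assumption)+

end

section \<open>Min-max values: sublevel events, finite nets, measurability and limits\<close>

lemma min_max_le_iff:
  fixes f :: "'a::metric_space \<Rightarrow> 'b::metric_space \<Rightarrow> real"
  assumes "continuous_on (Eu \<times> Ev) (\<lambda>(u, v). f u v)"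
    and "compact Eu" "Eu \<noteq> {}" "compact Ev" "Ev \<noteq> {}"
  shows "min_max Ev Eu f \<le> t \<longleftrightarrow> (\<exists>v\<in>Ev. \<forall>u\<in>Eu. f u v \<le> t)"
proof
  assume le: "min_max Ev Eu f \<le> t"
  obtain v where v: "v \<in> Ev" "(SUP u\<in>Eu. f u v) = min_max Ev Eu f"
    using min_max_attained(2)[OF assms] by blast
  obtain u where "\<forall>u'\<in>Eu. f u' v \<le> f u v" "f u v = (SUP u\<in>Eu. f u v)"
    using min_max_attained(1)[OF assms v(1)] by blast
  then have "\<forall>u\<in>Eu. f u v \<le> t" using v(2) le by auto
  then show "\<exists>v\<in>Ev. \<forall>u\<in>Eu. f u v \<le> t" using v(1) by blast
next
  assume "\<exists>v\<in>Ev. \<forall>u\<in>Eu. f u v \<le> t"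
  then obtain v where v: "v \<in> Ev" "\<forall>u\<in>Eu. f u v \<le> t" by blast
  then have "(SUP u\<in>Eu. f u v) \<le> t" using assms(3) by (intro cSUP_least) auto
  then show "min_max Ev Eu f \<le> t" using min_max_attained(2)[OF assms] v(1) by force
qed

text \<open>Finite sets are compact, and every function on them is continuous.\<close>

lemma min_max_le_iff_finite:
  fixes f :: "'a::metric_space \<Rightarrow> 'b::metric_space \<Rightarrow> real"
  assumes "finite Eu" "Eu \<noteq> {}" "finite Ev" "Ev \<noteq> {}"
  shows "min_max Ev Eu f \<le> t \<longleftrightarrow> (\<exists>v\<in>Ev. \<forall>u\<in>Eu. f u v \<le> t)"
  by (rule min_max_le_iff) (use assms in \<open>auto intro: finite_imp_compact continuous_on_finite\<close>)

text \<open>Finite nets inside \<open>S\<close> whose mesh tends to 0; \<open>Suc n\<close> keeps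
  the mesh defined at \<open>n = 0\<close>.\<close>

definition net_seq :: "'a::metric_space set \<Rightarrow> (nat \<Rightarrow> 'a set) \<Rightarrow> bool" where
  "net_seq S N \<longleftrightarrow> (\<forall>n. finite (N n) \<and> N n \<noteq> {} \<and> N n \<subseteq> S \<and>
     (\<forall>x\<in>S. \<exists>y\<in>N n. dist x y < 1 / Suc n))"

lemma ex_net_seq:
  assumes "compact S" "S \<noteq> {}"
  shows "\<exists>N. net_seq S N"
proof -
  have "\<exists>K. finite K \<and> K \<noteq> {} \<and> K \<subseteq> S \<and> (\<forall>x\<in>S. \<exists>y\<in>K. dist x y < 1 / Suc n)" for n
  proof -
    have "0 < 1 / real (Suc n)" by simp
    then obtain K where K: "finite K" "K \<subseteq> S" "S \<subseteq> (\<Union>x\<in>K. ball x (1 / Suc n))"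
      using seq_compact_imp_totally_bounded assms(1)[unfolded compact_eq_seq_compact_metric] by metis
    moreover have "K \<noteq> {}" using K assms(2) by auto
    moreover have "\<forall>x\<in>S. \<exists>y\<in>K. dist x y < 1 / Suc n" using K(3) by (fastforce simp: dist_commute)
    ultimately show ?thesis by blast
  qed
  then show ?thesis unfolding net_seq_def by metis
qed

text \<open>By uniform continuity, moving either player to a nearby net point changes the payoff by
  less than \<open>e / 2\<close> once the mesh is below \<open>d\<close>. Moving the minimiser gives
  one inequality and moving the maximiser the other.\<close>

lemma min_max_net_tendsto:
  fixes f :: "'a::metric_space \<Rightarrow> 'b::metric_space \<Rightarrow> real"
  assumes f: "continuous_on (Eu \<times> Ev) (\<lambda>(u, v). f u v)"
    and E: "compact Eu" "Eu \<noteq> {}" "compact Ev" "Ev \<noteq> {}"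
    and U: "net_seq Eu U" and V: "net_seq Ev V"
  shows "(\<lambda>n. min_max (V n) (U n) f) \<longlonglongrightarrow> min_max Ev Eu f"
proof (rule LIMSEQ_I)
  fix e :: real assume e: "0 < e"
  have U': "finite (U n)" "U n \<noteq> {}" "U n \<subseteq> Eu" "\<And>x. x \<in> Eu \<Longrightarrow> \<exists>y\<in>U n. dist x y < 1 / Suc n" for n
    using U by (auto simp: net_seq_def)
  have V': "finite (V n)" "V n \<noteq> {}" "V n \<subseteq> Ev" "\<And>x. x \<in> Ev \<Longrightarrow> \<exists>y\<in>V n. dist x y < 1 / Suc n" for n
    using V by (auto simp: net_seq_def)
  have "uniformly_continuous_on (Eu \<times> Ev) (\<lambda>(u, v). f u v)"
    by (intro compact_uniformly_continuous f compact_Times E)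
  moreover have "0 < e / 2" using e by simp
  ultimately obtain d where d0: "d > 0" and d1: "\<forall>x\<in>Eu \<times> Ev. \<forall>x'\<in>Eu \<times> Ev. dist x' x < d \<longrightarrow>
      dist (case x' of (u, v) \<Rightarrow> f u v) (case x of (u, v) \<Rightarrow> f u v) < e / 2"
    unfolding uniformly_continuous_on_def by blast
  have "\<bar>f u' v' - f u v\<bar> < e / 2"
    if "u \<in> Eu" "v \<in> Ev" "u' \<in> Eu" "v' \<in> Ev" "dist (u', v') (u, v) < d" for u v u' v'
    using d1[rule_format, of "(u, v)" "(u', v')"] that by (simp add: dist_real_def)
  note d = d0 this
  obtain N where N: "1 / real (Suc N) < d" using d(1) nat_approx_posE by blast
  have "norm (min_max (V n) (U n) f - min_max Ev Eu f) < e" if n: "n \<ge> N" for n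
  proof -
    let ?m = "min_max (V n) (U n) f" and ?M = "min_max Ev Eu f"
    have nd: "1 / real (Suc n) < d" using n N by (smt (verit) frac_le of_nat_le_iff of_nat_0_less_iff zero_less_Suc Suc_le_mono)
    \<comment> \<open>An optimal \<open>v\<close> of the full problem is replaced by a nearby net
      point, which bounds the net value from above.\<close>
    obtain v where v: "v \<in> Ev" "\<And>u. u \<in> Eu \<Longrightarrow> f u v \<le> ?M"
      using min_max_le_iff[OF f E, of ?M] by auto
    obtain v' where v': "v' \<in> V n" "dist v v' < d" using V'(4)[OF v(1)] nd by (meson order_less_trans)
    have "f u v' \<le> ?M + e / 2" if u: "u \<in> U n" for u
    proof -
      have "u \<in> Eu" "v' \<in> Ev" by (rule subsetD[OF U'(3) u] subsetD[OF V'(3) v'(1)])+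
      then have "\<bar>f u v' - f u v\<bar> < e / 2" "f u v \<le> ?M"
        using d(2)[of u v u v'] v(1) v(2)[of u] v'(2) by (simp_all add: dist_Pair_Pair dist_commute)
      then show ?thesis by linarith
    qed
    then have "?m \<le> ?M + e / 2"
      using min_max_le_iff_finite[OF U'(1,2) V'(1,2)] v' by blast
    \<comment> \<open>Conversely \<open>w\<close> is optimal on the net, and every response
      \<open>u\<close> in \<open>Eu\<close> is close to a net response already controlled.\<close>
    moreover obtain w where w: "w \<in> V n" "\<And>u. u \<in> U n \<Longrightarrow> f u w \<le> ?m"
      using min_max_le_iff_finite[OF U'(1,2) V'(1,2), of n n f ?m] by auto
    have "f u w \<le> ?m + e / 2" if u: "u \<in> Eu" for u
    proof -
      obtain u' where u': "u' \<in> U n" "dist u u' < d" using U'(4)[OF u] nd by (meson order_less_trans)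
      have "u' \<in> Eu" "w \<in> Ev" by (rule subsetD[OF U'(3) u'(1)] subsetD[OF V'(3) w(1)])+
      then have "\<bar>f u w - f u' w\<bar> < e / 2" "f u' w \<le> ?m"
        using d(2)[of u' w u w] u w(2)[of u'] u' by (simp_all add: dist_Pair_Pair)
      then show ?thesis by linarith
    qed
    then have "?M \<le> ?m + e / 2"
      using min_max_le_iff[OF f E] w V'(3) by blast
    ultimately show ?thesis using e by (auto simp: abs_if)
  qed
  then show "\<exists>N. \<forall>n\<ge>N. norm (min_max (V n) (U n) f - min_max Ev Eu f) < e" by blast
qed

lemma borel_measurable_min_max_finite:
  fixes f :: "'w \<Rightarrow> 'a::metric_space \<Rightarrow> 'b::metric_space \<Rightarrow> real"
  assumes "finite Eu" "Eu \<noteq> {}" "finite Ev" "Ev \<noteq> {}"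
    and "\<And>u v. u \<in> Eu \<Longrightarrow> v \<in> Ev \<Longrightarrow> (\<lambda>w. f w u v) \<in> borel_measurable M"
  shows "(\<lambda>w. min_max Ev Eu (f w)) \<in> borel_measurable M"
  unfolding borel_measurable_iff_le
proof
  fix t
  have "{w \<in> space M. min_max Ev Eu (f w) \<le> t} = {w \<in> space M. \<exists>v\<in>Ev. \<forall>u\<in>Eu. f w u v \<le> t}"
    using min_max_le_iff_finite[OF assms(1-4)] by blast
  also have "\<dots> \<in> sets M"
    using assms(1,3,5)
    by (intro sets.sets_Collect_finite_Ex sets.sets_Collect_finite_All borel_measurable_le borel_measurable_const)
      (auto simp: borel_measurable_iff_le)
  finally show "{w \<in> space M. min_max Ev Eu (f w) \<le> t} \<in> sets M" .
qed

lemma borel_measurable_min_max: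
  fixes f :: "'w \<Rightarrow> 'a::metric_space \<Rightarrow> 'b::metric_space \<Rightarrow> real"
  assumes f: "\<And>w. w \<in> space M \<Longrightarrow> continuous_on (Eu \<times> Ev) (\<lambda>(u, v). f w u v)"
    and E: "compact Eu" "compact Ev"
    and meas: "\<And>u v. u \<in> Eu \<Longrightarrow> v \<in> Ev \<Longrightarrow> (\<lambda>w. f w u v) \<in> borel_measurable M"
  shows "(\<lambda>w. min_max Ev Eu (f w)) \<in> borel_measurable M"
proof (cases "Eu = {} \<or> Ev = {}")
  \<comment> \<open>Over an empty set the value is a fixed default of \<open>Inf\<close> or
    \<open>Sup\<close>, hence constant in \<open>w\<close>.\<close>
  case True
  then show ?thesis by (auto simp: min_max_def)
next
  case False
  obtain U V where U: "net_seq Eu U" and V: "net_seq Ev V"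
    using ex_net_seq E False by metis
  show ?thesis
  proof (rule borel_measurable_LIMSEQ_real)
    show "(\<lambda>n. min_max (V n) (U n) (f w)) \<longlonglongrightarrow> min_max Ev Eu (f w)" if "w \<in> space M" for w
      using min_max_net_tendsto[OF f[OF that] E(1) _ E(2) _ U V] False by auto
    show "(\<lambda>w. min_max (V n) (U n) (f w)) \<in> borel_measurable M" for n
      by (rule borel_measurable_min_max_finite) (use U V meas in \<open>auto simp: net_seq_def subset_iff\<close>)
  qed
qed

text \<open>Pointwise convergence does not preserve closed events at a fixed level, so the levels
  are loosened by multiples of \<open>d\<close>, the index is sent to infinity, and only then
  \<open>d\<close> to 0.\<close>

lemma (in prob_space) prob_le_limit:
  fixes X Y :: "nat \<Rightarrow> 'a \<Rightarrow> real" and X' Y' :: "'a \<Rightarrow> real"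
  assumes [measurable]: "\<And>n. X n \<in> borel_measurable M" "\<And>n. Y n \<in> borel_measurable M"
      "X' \<in> borel_measurable M" "Y' \<in> borel_measurable M"
    and lim: "\<And>w. w \<in> space M \<Longrightarrow> (\<lambda>n. X n w) \<longlonglongrightarrow> X' w" "\<And>w. w \<in> space M \<Longrightarrow> (\<lambda>n. Y n w) \<longlonglongrightarrow> Y' w"
    and le: "\<And>n d. d > 0 \<Longrightarrow> \<P>(w in M. X n w \<le> t + d) \<le> \<P>(w in M. Y n w \<le> t + 2 * d)"
  shows "\<P>(w in M. X' w \<le> t) \<le> \<P>(w in M. Y' w \<le> t)"
proof -
  have step: "\<P>(w in M. X' w \<le> t) \<le> \<P>(w in M. Y' w \<le> t + 3 * d)" if d: "d > 0" for d
  proof -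
    \<comment> \<open>\<open>?A\<close> increases to "eventually below \<open>t + d\<close>" and
      \<open>?B\<close> decreases to "infinitely often below \<open>t + 2 * d\<close>"; the index
      \<open>N\<close> itself links the two.\<close>
    let ?A = "\<lambda>N. {w \<in> space M. \<forall>n\<ge>N. X n w \<le> t + d}"
    let ?B = "\<lambda>N. {w \<in> space M. \<exists>n\<ge>N. Y n w \<le> t + 2 * d}"
    have A: "(\<lambda>N. prob (?A N)) \<longlonglongrightarrow> prob (\<Union>N. ?A N)"
      by (intro finite_Lim_measure_incseq) (auto simp: incseq_def)
    have B: "(\<lambda>N. prob (?B N)) \<longlonglongrightarrow> prob (\<Inter>N. ?B N)"
      by (intro finite_Lim_measure_decseq) (auto simp: decseq_def intro: order_trans)
    have "prob (?A N) \<le> prob (?B N)" for N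
    proof -
      have "prob (?A N) \<le> \<P>(w in M. X N w \<le> t + d)" by (intro finite_measure_mono) auto
      also have "\<dots> \<le> \<P>(w in M. Y N w \<le> t + 2 * d)" by (rule le[OF d])
      also have "\<dots> \<le> prob (?B N)" by (intro finite_measure_mono) auto
      finally show ?thesis .
    qed
    then have AB: "prob (\<Union>N. ?A N) \<le> prob (\<Inter>N. ?B N)"
      using A B by (intro LIMSEQ_le[OF A B]) auto
    have "\<P>(w in M. X' w \<le> t) \<le> prob (\<Union>N. ?A N)"
    proof (intro finite_measure_mono subsetI)
      fix w assume w: "w \<in> {w \<in> space M. X' w \<le> t}"
      then have "eventually (\<lambda>n. X n w < t + d) sequentially"
        using d by (intro order_tendstoD(2)[OF lim(1)]) auto
      with w show "w \<in> (\<Union>N. ?A N)" by (auto simp: eventually_sequentially intro: less_imp_le)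
    qed auto
    also note AB
    also have "prob (\<Inter>N. ?B N) \<le> \<P>(w in M. Y' w \<le> t + 3 * d)"
    proof (intro finite_measure_mono subsetI)
      fix w assume w: "w \<in> (\<Inter>N. ?B N)"
      have "\<not> t + 3 * d < Y' w"
      proof
        assume "t + 3 * d < Y' w"
        then have "t + 2 * d < Y' w" using d by simp
        then have "eventually (\<lambda>n. t + 2 * d < Y n w) sequentially"
          using w by (intro order_tendstoD(1)[OF lim(2)]) auto
        then obtain N where N: "\<And>n. n \<ge> N \<Longrightarrow> t + 2 * d < Y n w" by (auto simp: eventually_sequentially)
        from w obtain n where "n \<ge> N" "Y n w \<le> t + 2 * d" by blast
        with N show False by force
      qed
      then show "w \<in> {w \<in> space M. Y' w \<le> t + 3 * d}" using w by auto
    qed auto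
    finally show ?thesis .
  qed
  \<comment> \<open>Continuity from above along \<open>d = 1 / Suc n\<close> removes the remaining
    slack.\<close>
  let ?C = "\<lambda>n. {w \<in> space M. Y' w \<le> t + 3 * (1 / Suc n)}"
  have "(\<lambda>n. prob (?C n)) \<longlonglongrightarrow> prob (\<Inter>n. ?C n)"
    by (intro finite_Lim_measure_decseq)
      (auto simp: decseq_def elim!: order_trans intro!: divide_left_mono)
  moreover have "(\<Inter>n. ?C n) = {w \<in> space M. Y' w \<le> t}"
  proof (intro equalityI subsetI)
    fix w assume w: "w \<in> (\<Inter>n. ?C n)"
    have "(\<lambda>n. t + 3 * (1 / real (Suc n))) \<longlonglongrightarrow> t + 3 * 0"
      by (intro tendsto_intros LIMSEQ_Suc lim_1_over_n)
    then have "Y' w \<le> t + 3 * 0" by (rule LIMSEQ_le_const) (use w in auto)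
    with w show "w \<in> {w \<in> space M. Y' w \<le> t}" by auto
  qed (auto intro: add_increasing2)
  ultimately have "(\<lambda>n. prob (?C n)) \<longlonglongrightarrow> \<P>(w in M. Y' w \<le> t)" by simp
  then show ?thesis
    by (rule LIMSEQ_le_const) (intro exI[of _ 0] allI impI step, simp)
qed

section \<open>Gordon's inequality on finite and compact index sets\<close>

lemma logistic_tendsto:
  "(\<lambda>n. logistic (real (Suc n) * y)) \<longlonglongrightarrow> (if y < 0 then 1 else if y = 0 then 1 / 2 else 0)"
proof -
  consider "y < 0" | "y = 0" | "y > 0" by linarith
  then show ?thesis
  proof cases
    case 1
    then have "(\<lambda>n. 1 / (1 + exp (real (Suc n) * y))) \<longlonglongrightarrow> 1" by real_asymp
    with 1 show ?thesis by (simp add: logistic_def)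
  next
    case 3
    then have "(\<lambda>n. 1 / (1 + exp (real (Suc n) * y))) \<longlonglongrightarrow> 0" by real_asymp
    with 3 show ?thesis by (simp add: logistic_def)
  qed (simp add: logistic_def)
qed

text \<open>As the sharpness grows, the smooth test converges to a limit \<open>F\<close> that is 1
  where the \<alpha> value exceeds \<open>t + d\<close> and 0 where the \<beta> value is at most
  \<open>t\<close>. The inequality of expectations thus compares the complementary events.\<close>

lemma gordon_finite:
  fixes \<alpha> \<beta> :: "'o::metric_space \<times> 'i::metric_space \<Rightarrow> 'k::finite \<Rightarrow> real"
  assumes V: "finite V" "V \<noteq> {}" and U: "finite U" "U \<noteq> {}"
    and orth: "\<And>i j. i \<in> V \<times> U \<Longrightarrow> j \<in> V \<times> U \<Longrightarrow> (\<Sum>k\<in>UNIV. \<alpha> i k * \<beta> j k) = 0"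
    and same: "\<And>v u u'. v \<in> V \<Longrightarrow> u \<in> U \<Longrightarrow> u' \<in> U \<Longrightarrow>
      (\<Sum>k\<in>UNIV. \<alpha> (v, u) k * \<alpha> (v, u') k) = (\<Sum>k\<in>UNIV. \<beta> (v, u) k * \<beta> (v, u') k)"
    and cross: "\<And>i j. i \<in> V \<times> U \<Longrightarrow> j \<in> V \<times> U \<Longrightarrow>
      (\<Sum>k\<in>UNIV. \<alpha> i k * \<alpha> j k) \<le> (\<Sum>k\<in>UNIV. \<beta> i k * \<beta> j k)"
    and d: "d > 0"
  shows "\<P>(w in gauss_prod. min_max V U (\<lambda>u v. (\<Sum>k\<in>UNIV. \<beta> (v, u) k * w k) + q (v, u)) \<le> t)
    \<le> \<P>(w in gauss_prod. min_max V U (\<lambda>u v. (\<Sum>k\<in>UNIV. \<alpha> (v, u) k * w k) + q (v, u)) \<le> t + d)"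
proof -
  interpret prob_space "gauss_prod :: ('k \<Rightarrow> real) measure" by (rule prob_space_gauss_prod)
  define Z where "Z c w i = (\<Sum>k\<in>UNIV. c i k * w k)"
    for c :: "'o \<times> 'i \<Rightarrow> 'k \<Rightarrow> real" and w :: "'k \<Rightarrow> real" and i
  define X where "X c w = min_max V U (\<lambda>u v. Z c w (v, u) + q (v, u))" for c w
  \<comment> \<open>The threshold is placed midway between \<open>t\<close> and
    \<open>t + d\<close>, so on both events of interest the relevant arguments of \<open>L\<close>
    stay away from 0.\<close>
  define q' where "q' i = q i - t - d / 2" for i
  \<comment> \<open>The pointwise limit of the logistic functions; the value \<open>1 / 2\<close> at
    0 falls into the gap left by the threshold.\<close>
  define L :: "real \<Rightarrow> real" where "L y = (if y < 0 then 1 else if y = 0 then 1 / 2 else 0)" for y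
  define F where "F x = (\<Prod>v\<in>V. 1 - (\<Prod>u\<in>U. L (x (v, u) + q' (v, u))))" for x :: "'o \<times> 'i \<Rightarrow> real"
  let ?F = "\<lambda>n. gordon_test.F V U q' (real (Suc n))"
  have gt: "gordon_test V U (real (Suc n))" for n
    by unfold_locales (use U V in auto)
  have Zm[measurable]: "(\<lambda>w. Z c w i) \<in> borel_measurable gauss_prod" for c i
    unfolding Z_def by measurable
  have [measurable]: "X c \<in> borel_measurable gauss_prod" for c
    unfolding X_def by (rule borel_measurable_min_max_finite) (use U V in auto)
  have le_iff: "X c w \<le> s \<longleftrightarrow> (\<exists>v\<in>V. \<forall>u\<in>U. Z c w (v, u) + q (v, u) \<le> s)" for c w s
    unfolding X_def by (rule min_max_le_iff_finite[OF U V])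
  have lim: "(\<lambda>n. ?F n x) \<longlonglongrightarrow> F x" for x
    unfolding F_def gordon_test.F_def[OF gt] gordon_test.T_def[OF gt] gordon_test.s_def[OF gt] L_def
    by (intro tendsto_prod tendsto_diff tendsto_const logistic_tendsto)
  have Fn_meas: "(\<lambda>w. ?F n (Z c w)) \<in> borel_measurable gauss_prod" for n c
    by (rule gordon_test.measurable_F[OF gt Zm])
  have F_meas[measurable]: "(\<lambda>w. F (Z c w)) \<in> borel_measurable gauss_prod" for c
    by (rule borel_measurable_LIMSEQ_real[OF lim Fn_meas])
  have L01: "0 \<le> L y" "L y \<le> 1" for y by (auto simp: L_def)
  have F01: "0 \<le> F x" "F x \<le> 1" for x
    unfolding F_def by (auto intro!: prod_nonneg prod_le_1 L01 simp: prod_le_1 prod_nonneg L01)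
  have int: "integrable gauss_prod (\<lambda>w. F (Z c w))" for c
    by (rule integrable_const_bound[where B = 1]) (use F01 in auto)
  have conv: "(\<lambda>n. \<integral>w. ?F n (Z c w) \<partial>gauss_prod) \<longlonglongrightarrow> (\<integral>w. F (Z c w) \<partial>gauss_prod)" for c
    by (rule integral_dominated_convergence[where w = "\<lambda>_. 1"])
      (use gordon_test.F_bounds[OF gt] Fn_meas lim in auto)
  have "(\<integral>w. ?F n (Z \<alpha> w) \<partial>gauss_prod) \<le> (\<integral>w. ?F n (Z \<beta> w) \<partial>gauss_prod)" for n
    unfolding Z_def[abs_def] by (rule gordon_test.expectation_mono[OF gt]) (fact orth same cross)+
  then have E: "(\<integral>w. F (Z \<alpha> w) \<partial>gauss_prod) \<le> (\<integral>w. F (Z \<beta> w) \<partial>gauss_prod)"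
    by (intro LIMSEQ_le[OF conv conv]) auto
  have "\<P>(w in gauss_prod. \<not> X \<alpha> w \<le> t + d) = (\<integral>w. indicator {w \<in> space gauss_prod. \<not> X \<alpha> w \<le> t + d} w \<partial>gauss_prod)"
    by simp
  also have "\<dots> \<le> (\<integral>w. F (Z \<alpha> w) \<partial>gauss_prod)"
  proof (rule integral_mono[OF _ int])
    show "integrable gauss_prod (indicator {w \<in> space gauss_prod. \<not> X \<alpha> w \<le> t + d} :: _ \<Rightarrow> real)"
      by (rule integrable_real_indicator) (auto simp: emeasure_eq_measure)
    fix w
    have "F (Z \<alpha> w) = 1" if "\<not> X \<alpha> w \<le> t + d"
      unfolding F_def
    proof (rule prod.neutral, rule ballI)
      fix v assume "v \<in> V"
      then have "\<exists>u\<in>U. Z \<alpha> w (v, u) + q (v, u) > t + d" using that by (auto simp: le_iff not_le)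
      then obtain u where u: "u \<in> U" "Z \<alpha> w (v, u) + q (v, u) > t + d" by blast
      then have "L (Z \<alpha> w (v, u) + q' (v, u)) = 0" using d by (auto simp: L_def q'_def)
      then have "(\<Prod>u\<in>U. L (Z \<alpha> w (v, u) + q' (v, u))) = 0" using u U by (intro prod_zero) auto
      then show "1 - (\<Prod>u\<in>U. L (Z \<alpha> w (v, u) + q' (v, u))) = 1" by simp
    qed
    then show "indicator {w \<in> space gauss_prod. \<not> X \<alpha> w \<le> t + d} w \<le> F (Z \<alpha> w)"
      using F01 by (auto simp: indicator_def)
  qed
  also note E
  also have "(\<integral>w. F (Z \<beta> w) \<partial>gauss_prod) \<le> (\<integral>w. indicator {w \<in> space gauss_prod. \<not> X \<beta> w \<le> t} w \<partial>gauss_prod)"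
  proof (rule integral_mono[OF int])
    show "integrable gauss_prod (indicator {w \<in> space gauss_prod. \<not> X \<beta> w \<le> t} :: _ \<Rightarrow> real)"
      by (rule integrable_real_indicator) (auto simp: emeasure_eq_measure)
    fix w :: "'k \<Rightarrow> real" assume w: "w \<in> space gauss_prod"
    have "F (Z \<beta> w) = 0" if le: "X \<beta> w \<le> t"
    proof -
      obtain v where v: "v \<in> V" "\<forall>u\<in>U. Z \<beta> w (v, u) + q (v, u) \<le> t" using le unfolding le_iff by blast
      then have "L (Z \<beta> w (v, u) + q' (v, u)) = 1" if "u \<in> U" for u
        using d that by (force simp: L_def q'_def)
      then have "1 - (\<Prod>u\<in>U. L (Z \<beta> w (v, u) + q' (v, u))) = 0" by simp
      then show ?thesis unfolding F_def using v V by (intro prod_zero) auto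
    qed
    then show "F (Z \<beta> w) \<le> indicator {w \<in> space gauss_prod. \<not> X \<beta> w \<le> t} w"
      using F01 w by (auto simp: indicator_def)
  qed
  also have "\<dots> = \<P>(w in gauss_prod. \<not> X \<beta> w \<le> t)" by simp
  finally have "1 - \<P>(w in gauss_prod. X \<alpha> w \<le> t + d) \<le> 1 - \<P>(w in gauss_prod. X \<beta> w \<le> t)"
    by (subst (asm) (1 2) prob_neg) auto
  then show ?thesis by (simp add: X_def Z_def)
qed

text \<open>The finite version is applied on ever finer nets; its slack \<open>d\<close> is absorbed
  in the limit by \<open>prob_le_limit\<close>.\<close>

lemma gordon_compact:
  fixes \<alpha> \<beta> :: "'o::metric_space \<times> 'i::metric_space \<Rightarrow> 'k::finite \<Rightarrow> real"
  assumes V: "compact V" "V \<noteq> {}" and U: "compact U" "U \<noteq> {}"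
    and cont: "\<And>k. continuous_on (V \<times> U) (\<lambda>i. \<alpha> i k)" "\<And>k. continuous_on (V \<times> U) (\<lambda>i. \<beta> i k)"
      "continuous_on (V \<times> U) q"
    and orth: "\<And>i j. i \<in> V \<times> U \<Longrightarrow> j \<in> V \<times> U \<Longrightarrow> (\<Sum>k\<in>UNIV. \<alpha> i k * \<beta> j k) = 0"
    and same: "\<And>v u u'. v \<in> V \<Longrightarrow> u \<in> U \<Longrightarrow> u' \<in> U \<Longrightarrow>
      (\<Sum>k\<in>UNIV. \<alpha> (v, u) k * \<alpha> (v, u') k) = (\<Sum>k\<in>UNIV. \<beta> (v, u) k * \<beta> (v, u') k)"
    and cross: "\<And>i j. i \<in> V \<times> U \<Longrightarrow> j \<in> V \<times> U \<Longrightarrow>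
      (\<Sum>k\<in>UNIV. \<alpha> i k * \<alpha> j k) \<le> (\<Sum>k\<in>UNIV. \<beta> i k * \<beta> j k)"
  shows "\<P>(w in gauss_prod. min_max V U (\<lambda>u v. (\<Sum>k\<in>UNIV. \<beta> (v, u) k * w k) + q (v, u)) \<le> t)
    \<le> \<P>(w in gauss_prod. min_max V U (\<lambda>u v. (\<Sum>k\<in>UNIV. \<alpha> (v, u) k * w k) + q (v, u)) \<le> t)"
proof -
  interpret prob_space "gauss_prod :: ('k \<Rightarrow> real) measure" by (rule prob_space_gauss_prod)
  define f where "f c w u v = (\<Sum>k\<in>UNIV. c (v, u) k * w k) + q (v, u)"
    for c :: "'o \<times> 'i \<Rightarrow> 'k \<Rightarrow> real" and w :: "'k \<Rightarrow> real" and u v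
  \<comment> \<open>Coefficients are indexed by \<open>(v, u)\<close>, with the row first, whereas
    payoffs inside \<open>min_max\<close> take \<open>u\<close> first.\<close>
  have swap: "continuous_on (U \<times> V) (\<lambda>p. h (snd p, fst p))" if "continuous_on (V \<times> U) h" for h :: "_ \<Rightarrow> real"
    by (rule continuous_on_compose2[OF that]) (auto intro!: continuous_intros)
  have f_cont: "continuous_on (U \<times> V) (\<lambda>(u, v). f c w u v)"
    if "\<And>k. continuous_on (V \<times> U) (\<lambda>i. c i k)" for c w
    unfolding f_def split_def
    by (intro continuous_on_add continuous_on_sum continuous_on_mult continuous_on_const
        swap[OF that] swap[OF cont(3)])
  have f_meas: "(\<lambda>w. f c w u v) \<in> borel_measurable gauss_prod" for c u v
    unfolding f_def by measurable
  obtain N N' where N: "net_seq U N" "net_seq V N'" using ex_net_seq U V by metis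
  have N': "finite (N n)" "N n \<noteq> {}" "N n \<subseteq> U" "finite (N' n)" "N' n \<noteq> {}" "N' n \<subseteq> V" for n
    using N by (auto simp: net_seq_def)
  show ?thesis
    unfolding f_def[symmetric]
  proof (rule prob_le_limit)
    show "(\<lambda>n. min_max (N' n) (N n) (f \<beta> w)) \<longlonglongrightarrow> min_max V U (f \<beta> w)" for w
      by (rule min_max_net_tendsto[OF f_cont[OF cont(2)] U V N])
    show "(\<lambda>n. min_max (N' n) (N n) (f \<alpha> w)) \<longlonglongrightarrow> min_max V U (f \<alpha> w)" for w
      by (rule min_max_net_tendsto[OF f_cont[OF cont(1)] U V N])
    show "(\<lambda>w. min_max V U (f \<alpha> w)) \<in> borel_measurable gauss_prod"
      by (rule borel_measurable_min_max[OF f_cont[OF cont(1)] U(1) V(1) f_meas])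
    show "(\<lambda>w. min_max V U (f \<beta> w)) \<in> borel_measurable gauss_prod"
      by (rule borel_measurable_min_max[OF f_cont[OF cont(2)] U(1) V(1) f_meas])
    show "(\<lambda>w. min_max (N' n) (N n) (f \<alpha> w)) \<in> borel_measurable gauss_prod"
      "(\<lambda>w. min_max (N' n) (N n) (f \<beta> w)) \<in> borel_measurable gauss_prod" for n
      by (rule borel_measurable_min_max_finite[OF N'(1,2,4,5) f_meas])+
    fix n and d :: real assume d: "d > 0"
    have sub: "N' n \<times> N n \<subseteq> V \<times> U" using N' by blast
    have "\<P>(w in gauss_prod. min_max (N' n) (N n) (f \<beta> w) \<le> t + d)
      \<le> \<P>(w in gauss_prod. min_max (N' n) (N n) (f \<alpha> w) \<le> t + d + d)"
      unfolding f_def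
      by (rule gordon_finite[OF N'(4,5,1,2), where \<alpha> = \<alpha> and \<beta> = \<beta>])
        (use sub N'(3,6)[of n] d in \<open>auto intro!: orth same cross\<close>)
    then show "\<P>(w in gauss_prod. min_max (N' n) (N n) (f \<beta> w) \<le> t + d)
      \<le> \<P>(w in gauss_prod. min_max (N' n) (N n) (f \<alpha> w) \<le> t + 2 * d)"
      by (simp add: algebra_simps)
  qed
qed

subsection \<open>The minimax theorem\<close>

text \<open>The minimax theorem for two functions: in the plane, the convex set of points dominating
  some value pair \<open>(p v, q v)\<close> is separated from an open quadrant, and the normalised
  normal vector supplies the weights.\<close>

lemma convex_pair_combination:
  fixes p q :: "'a::euclidean_space \<Rightarrow> real"
  assumes S: "compact S" and p: "convex_on S p" "continuous_on S p"
    and q: "convex_on S q" "continuous_on S q"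
    and pos: "\<And>v. v \<in> S \<Longrightarrow> 0 < p v \<or> 0 < q v"
  shows "\<exists>l\<in>{0..1}. \<forall>v\<in>S. 0 < (1 - l) * p v + l * q v"
proof (cases "S = {}")
  case True
  then show ?thesis by auto
next
  case False
  have "continuous_on S (\<lambda>v. max (p v) (q v))" by (intro continuous_on_max p q)
  then obtain v0 where v0: "v0 \<in> S" "\<And>v. v \<in> S \<Longrightarrow> max (p v0) (q v0) \<le> max (p v) (q v)"
    using continuous_attains_inf[OF S False] by blast
  \<comment> \<open>Compactness makes the pointwise positivity of \<open>max (p v) (q v)\<close>
    uniform.\<close>
  define d where "d = max (p v0) (q v0)"
  have d: "d > 0" "\<And>v. v \<in> S \<Longrightarrow> d \<le> p v \<or> d \<le> q v"
    using pos[OF v0(1)] v0(2) by (force simp: d_def le_max_iff_disj)+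
  define T where "T = {x::real \<times> real. \<exists>v\<in>S. p v \<le> fst x \<and> q v \<le> snd x}"
  define N where "N = {x::real \<times> real. fst x < d \<and> snd x < d}"
  have "convex T"
    unfolding convex_def
  proof (intro ballI allI impI)
    fix x y :: "real \<times> real" and a b :: real
    assume x: "x \<in> T" and y: "y \<in> T" and ab: "0 \<le> a" "0 \<le> b" "a + b = 1"
    obtain v w where vw: "v \<in> S" "p v \<le> fst x" "q v \<le> snd x" "w \<in> S" "p w \<le> fst y" "q w \<le> snd y"
      using x y by (auto simp: T_def)
    have "convex S" using p(1) by (rule convex_on_imp_convex)
    then have "a *\<^sub>R v + b *\<^sub>R w \<in> S" using vw ab by (simp add: convexD)
    moreover have "p (a *\<^sub>R v + b *\<^sub>R w) \<le> a * p v + b * p w" "q (a *\<^sub>R v + b *\<^sub>R w) \<le> a * q v + b * q w"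
      using p(1) q(1) vw ab by (auto simp: convex_on_def)
    moreover have "a * p v + b * p w \<le> a * fst x + b * fst y" "a * q v + b * q w \<le> a * snd x + b * snd y"
      using vw ab by (auto intro!: add_mono mult_left_mono)
    ultimately show "a *\<^sub>R x + b *\<^sub>R y \<in> T"
      unfolding T_def by (auto intro!: bexI[of _ "a *\<^sub>R v + b *\<^sub>R w"])
  qed
  moreover have "convex N"
  proof -
    have "N = {..<d} \<times> {..<d}" by (auto simp: N_def)
    then show ?thesis by (auto intro: convex_Times)
  qed
  moreover have "N \<noteq> {}" by (auto simp: N_def intro!: exI[of _ "d - 1"])
  moreover have "T \<noteq> {}" using False by (auto simp: T_def)
  moreover have "N \<inter> T = {}" using d(2) by (fastforce simp: N_def T_def)
  ultimately obtain a b where ab: "a \<noteq> 0" "\<forall>x\<in>N. a \<bullet> x \<le> b" "\<forall>x\<in>T. b \<le> a \<bullet> x"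
    using separating_hyperplane_sets[of N T] by (auto simp: inner_commute)
  obtain a1 a2 where a: "a = (a1, a2)" by (cases a)
  have N: "a1 * x + a2 * y \<le> b" if "x < d" "y < d" for x y
    using ab(2) that by (auto simp: N_def a)
  have T: "b \<le> a1 * p v + a2 * q v" if "v \<in> S" for v
    using ab(3)[rule_format, of "(p v, q v)"] that by (auto simp: T_def a)
  \<comment> \<open>\<open>N\<close> is unbounded towards minus infinity in each coordinate, so a
    negative coefficient would push the linear form above \<open>b\<close>; the chosen
    \<open>x\<close> is far enough out.\<close>
  have nonneg: "0 \<le> c" if "\<And>x. x < d \<Longrightarrow> c * x + e \<le> b" for c e
  proof (rule ccontr)
    assume "\<not> 0 \<le> c"
    then have c: "c < 0" by simp
    define x where "x = min (d - 1) ((b - e + 1) / c)"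
    have "c * ((b - e + 1) / c) \<le> c * x" using c by (intro mult_left_mono_neg) (auto simp: x_def)
    then have "b - e + 1 \<le> c * x" using c by simp
    moreover have "c * x + e \<le> b" by (rule that) (simp add: x_def)
    ultimately show False by simp
  qed
  have a1: "0 \<le> a1" by (rule nonneg[of _ "a2 * (d - 1)"]) (use N in auto)
  have a2: "0 \<le> a2" by (rule nonneg[of _ "a1 * (d - 1)"]) (use N[of "d - 1"] in \<open>simp add: add.commute\<close>)
  have sum: "0 < a1 + a2" using a1 a2 ab(1) a by (auto simp: zero_prod_def)
  \<comment> \<open>The point \<open>(d / 2, d / 2)\<close> of \<open>N\<close> forces the
    separating level to be positive.\<close>
  have "b > 0"
  proof -
    have "a1 * (d / 2) + a2 * (d / 2) \<le> b" by (rule N) (use d in auto)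
    moreover have "0 < (a1 + a2) * (d / 2)" using sum d by simp
    ultimately show ?thesis by (simp add: algebra_simps)
  qed
  define l where "l = a2 / (a1 + a2)"
  have l: "l \<in> {0..1}" "1 - l = a1 / (a1 + a2)" using a1 a2 sum by (auto simp: l_def field_simps)
  have "0 < (1 - l) * p v + l * q v" if "v \<in> S" for v
  proof -
    have "(1 - l) * p v + l * q v = (a1 * p v + a2 * q v) / (a1 + a2)"
      unfolding l(2) by (simp add: l_def add_divide_distrib)
    also have "0 < \<dots>" using T[OF that] \<open>b > 0\<close> sum by simp
    finally show ?thesis .
  qed
  with l(1) show ?thesis by blast
qed

text \<open>Induction on \<open>K\<close>. For a new point \<open>u\<close>, the hypothesis is
  applied on the compact convex set where \<open>f u\<close> is at most \<open>c\<close>, giving one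
  \<open>u'\<close> that handles it. The points \<open>u\<close> and \<open>u'\<close> then cover
  \<open>Ev\<close>, and concavity turns the weights of the two-function case into a single point.
  \<open>Ev\<close> is generalised because it shrinks.\<close>

lemma minimax_finite:
  fixes f :: "'a::euclidean_space \<Rightarrow> 'b::euclidean_space \<Rightarrow> real"
  assumes K: "finite K" "K \<subseteq> Eu" "K \<noteq> {}"
    and Eu: "convex Eu" and Ev: "compact Ev"
    and cont: "\<And>u. u \<in> Eu \<Longrightarrow> continuous_on Ev (f u)"
    and conv: "\<And>u. u \<in> Eu \<Longrightarrow> convex_on Ev (f u)"
    and conc: "\<And>v. v \<in> Ev \<Longrightarrow> concave_on Eu (\<lambda>u. f u v)"
    and pos: "\<And>v. v \<in> Ev \<Longrightarrow> \<exists>u\<in>K. c < f u v"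
  shows "\<exists>u\<in>Eu. \<forall>v\<in>Ev. c < f u v"
  using K(1,3,2) Ev cont conv conc pos
proof (induction K arbitrary: Ev rule: finite_ne_induct)
  case (singleton u)
  then show ?case by (intro bexI[of _ u]) auto
next
  case (insert u K)
  note cont = insert.prems(3) and conv = insert.prems(4) and conc = insert.prems(5)
  have u: "u \<in> Eu" using insert.prems(1) by auto
  let ?W = "{v \<in> Ev. f u v \<le> c}"
  have W: "compact ?W" "convex ?W"
  proof -
    have "closed {v \<in> Ev. f u v \<le> c}"
      by (rule continuous_on_closed_Collect_le)
        (use insert.prems(2) cont[OF u] in \<open>auto intro: compact_imp_closed\<close>)
    then have "compact (Ev \<inter> ?W)" using insert.prems(2) by (rule compact_Int_closed[rotated])
    moreover have "Ev \<inter> ?W = ?W" by auto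
    ultimately show "compact ?W" by simp
    show "convex ?W"
      unfolding convex_def
    proof (intro ballI allI impI)
      fix x y and a b :: real
      assume xy: "x \<in> ?W" "y \<in> ?W" and ab: "0 \<le> a" "0 \<le> b" "a + b = 1"
      have "f u (a *\<^sub>R x + b *\<^sub>R y) \<le> a * f u x + b * f u y"
        using conv[OF u] xy ab by (auto simp: convex_on_def)
      also have "\<dots> \<le> a * c + b * c" using xy ab by (intro add_mono mult_left_mono) auto
      also have "\<dots> = c" using ab by (simp add: distrib_right[symmetric])
      finally show "a *\<^sub>R x + b *\<^sub>R y \<in> ?W"
        using convexD[OF convex_on_imp_convex[OF conv[OF u]]] xy ab by auto
    qed
  qed
  have "\<exists>u'\<in>Eu. \<forall>v\<in>?W. c < f u' v"
  proof (rule insert.IH)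
    show "\<exists>u\<in>K. c < f u v" if "v \<in> ?W" for v using that insert.prems(6)[of v] by force
    show "continuous_on ?W (f w)" if "w \<in> Eu" for w using cont[OF that] by (rule continuous_on_subset) auto
    show "convex_on ?W (f w)" if "w \<in> Eu" for w
      by (rule convex_on_subset[OF conv[OF that] _ W(2)]) auto
  qed (use W insert.prems in auto)
  then obtain u' where u': "u' \<in> Eu" "\<And>v. v \<in> ?W \<Longrightarrow> c < f u' v" by blast
  have conv_c: "convex_on Ev (\<lambda>v. f w v - c)" if "w \<in> Eu" for w
    using convex_on_add[OF conv[OF that], of "\<lambda>_. - c"] convex_on_imp_convex[OF conv[OF that]]
    by (auto simp: convex_on_const)
  have "\<exists>l\<in>{0..1}. \<forall>v\<in>Ev. 0 < (1 - l) * (f u v - c) + l * (f u' v - c)"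
  proof (rule convex_pair_combination[OF insert.prems(2) conv_c[OF u] _ conv_c[OF u'(1)]])
    show "continuous_on Ev (\<lambda>v. f u v - c)" "continuous_on Ev (\<lambda>v. f u' v - c)"
      by (intro continuous_intros cont u u')+
    show "0 < f u v - c \<or> 0 < f u' v - c" if "v \<in> Ev" for v
      using u'(2)[of v] that by force
  qed
  then obtain l where l: "0 \<le> l" "l \<le> 1" "\<And>v. v \<in> Ev \<Longrightarrow> 0 < (1 - l) * (f u v - c) + l * (f u' v - c)"
    by auto
  have "c < f ((1 - l) *\<^sub>R u + l *\<^sub>R u') v" if v: "v \<in> Ev" for v
  proof -
    have "(1 - l) * f u v + l * f u' v \<le> f ((1 - l) *\<^sub>R u + l *\<^sub>R u') v"
      using concave_onD[OF conc[OF v] l(1,2) u u'(1)] by simp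
    moreover have "c < (1 - l) * f u v + l * f u' v" using l(3)[OF v] by (simp add: algebra_simps)
    ultimately show ?thesis by simp
  qed
  moreover have "(1 - l) *\<^sub>R u + l *\<^sub>R u' \<in> Eu" using Eu u u'(1) l by (simp add: convexD_alt)
  ultimately show ?case by blast
qed

text \<open>The sets where \<open>f u\<close> exceeds \<open>c\<close> are relatively open and cover
  \<open>Ev\<close>, so compactness reduces the claim to finitely many \<open>u\<close>.\<close>

lemma minimax_exists:
  fixes f :: "'a::euclidean_space \<Rightarrow> 'b::euclidean_space \<Rightarrow> real"
  assumes Eu: "convex Eu" "Eu \<noteq> {}" and Ev: "compact Ev"
    and cont: "\<And>u. u \<in> Eu \<Longrightarrow> continuous_on Ev (f u)"
    and conv: "\<And>u. u \<in> Eu \<Longrightarrow> convex_on Ev (f u)"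
    and conc: "\<And>v. v \<in> Ev \<Longrightarrow> concave_on Eu (\<lambda>u. f u v)"
    and pos: "\<And>v. v \<in> Ev \<Longrightarrow> \<exists>u\<in>Eu. c < f u v"
  shows "\<exists>u\<in>Eu. \<forall>v\<in>Ev. c < f u v"
proof -
  have "\<exists>G. open G \<and> G \<inter> Ev = {v \<in> Ev. c < f u v}" if "u \<in> Eu" for u
    using continuous_on_open_invariant[THEN iffD1, OF cont[OF that], rule_format, of "{c<..}"]
    by (auto simp: vimage_def Int_def conj_commute)
  then obtain G where G: "\<And>u. u \<in> Eu \<Longrightarrow> open (G u)" "\<And>u. u \<in> Eu \<Longrightarrow> G u \<inter> Ev = {v \<in> Ev. c < f u v}"
    by metis
  have "Ev \<subseteq> (\<Union>u\<in>Eu. G u)" using pos G(2) by blast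
  then obtain K where K: "K \<subseteq> Eu" "finite K" "Ev \<subseteq> (\<Union>u\<in>K. G u)"
    using compactE_image[OF Ev, of Eu G] G(1) by metis
  show ?thesis
  proof (cases "Ev = {}")
    case True
    then show ?thesis using Eu by auto
  next
    case False
    show ?thesis
    proof (rule minimax_finite[OF K(2,1) _ Eu(1) Ev cont conv conc])
      show "K \<noteq> {}" using K(3) False by auto
      show "\<exists>u\<in>K. c < f u v" if "v \<in> Ev" for v using K(1,3) G(2) that by blast
    qed
  qed
qed

subsection \<open>The comparison for Gaussian bilinear forms\<close>

text \<open>Splits the index set into the auxiliary normal and the blocks of \<open>A\<close>,
  \<open>zg\<close> and \<open>zh\<close>, so that covariances are computed block by block.\<close>

lemma sum_UNIV_option_entries:
  fixes f :: "(('N::finite \<times> 'p::finite) + ('p + 'N)) option \<Rightarrow> real"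
  shows "(\<Sum>k\<in>UNIV. f k) = f None + ((\<Sum>m\<in>UNIV. \<Sum>n\<in>UNIV. f (Some (Inl (m, n))))
    + ((\<Sum>n\<in>UNIV. f (Some (Inr (Inl n)))) + (\<Sum>m\<in>UNIV. f (Some (Inr (Inr m))))))"
proof -
  have "(\<Sum>k\<in>UNIV. f k) = f None + (\<Sum>k\<in>UNIV. f (Some k))"
    unfolding UNIV_option_conv by (simp add: sum.reindex)
  also have "(\<Sum>k\<in>UNIV. f (Some k)) = (\<Sum>k\<in>UNIV. f (Some (Inl k))) + (\<Sum>k\<in>UNIV. f (Some (Inr k)))"
    using sum.Plus[of "UNIV :: ('N \<times> 'p) set" "UNIV :: ('p + 'N) set" "\<lambda>k. f (Some k)"] by simp
  also have "(\<Sum>k\<in>UNIV. f (Some (Inr k))) = (\<Sum>n\<in>UNIV. f (Some (Inr (Inl n)))) + (\<Sum>m\<in>UNIV. f (Some (Inr (Inr m))))"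
    using sum.Plus[of "UNIV :: 'p set" "UNIV :: 'N set" "\<lambda>k. f (Some (Inr k))"] by simp
  also have "(\<Sum>k\<in>UNIV. f (Some (Inl k))) = (\<Sum>m\<in>UNIV. \<Sum>n\<in>UNIV. f (Some (Inl (m, n))))"
    unfolding UNIV_Times_UNIV[symmetric] by (simp add: sum.cartesian_product)
  finally show ?thesis .
qed

text \<open>Independence together with the marginals determines the joint law; this moves events
  from \<open>M\<close> to the canonical product space.\<close>

lemma distr_gaussian_entries:
  fixes A :: "'w \<Rightarrow> real^'p^'N"
  assumes M: "prob_space M" and ind: "indep_std_gaussians M A zg zh"
  shows "distr M gauss_prod (\<lambda>w k. gaussian_entries A zg zh k w) = gauss_prod"
    and "(\<lambda>w k. gaussian_entries A zg zh k w) \<in> M \<rightarrow>\<^sub>M gauss_prod"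
proof -
  interpret prob_space M by fact
  let ?X = "gaussian_entries A zg zh"
  have d: "distributed M lborel (?X k) std_normal_density" for k
    using ind by (auto simp: indep_std_gaussians_def)
  have X[measurable]: "?X k \<in> borel_measurable M" for k
    using distributed_measurable[OF d] by simp
  have D: "distr M borel (?X k) = std_normal" for k
  proof -
    have "distr M borel (?X k) = distr M lborel (?X k)" by (intro distr_cong) auto
    then show ?thesis using distributed_distr_eq_density[OF d] by simp
  qed
  have s: "sets (gauss_prod :: (('N \<times> 'p) + ('p + 'N) \<Rightarrow> real) measure) = sets (Pi\<^sub>M UNIV (\<lambda>_. borel))"
    by (intro sets_PiM_cong) auto
  have "distr M (Pi\<^sub>M UNIV (\<lambda>_. borel)) (\<lambda>w. \<lambda>k\<in>UNIV. ?X k w) = Pi\<^sub>M UNIV (\<lambda>k. distr M borel (?X k))"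
    using ind X by (subst indep_vars_iff_distr_eq_PiM[symmetric]) (auto simp: indep_std_gaussians_def)
  then have "distr M (Pi\<^sub>M UNIV (\<lambda>_. borel)) (\<lambda>w k. ?X k w) = gauss_prod"
    unfolding D by (simp add: restrict_def)
  moreover have "distr M gauss_prod (\<lambda>w k. ?X k w) = distr M (Pi\<^sub>M UNIV (\<lambda>_. borel)) (\<lambda>w k. ?X k w)"
    by (intro distr_cong) (use s in auto)
  ultimately show "distr M gauss_prod (\<lambda>w k. ?X k w) = gauss_prod" by simp
  show "(\<lambda>w k. ?X k w) \<in> M \<rightarrow>\<^sub>M gauss_prod"
    by (subst measurable_cong_sets[OF refl s], rule measurable_PiM_single') (auto intro: X)
qed

text \<open>\<open>M\<close> may carry no further independent normal, so the auxiliary one lives at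
  the index \<open>None\<close> of a larger product; forgetting that coordinate recovers the
  original law.\<close>

lemma distr_gauss_prod_Some:
  "distr (gauss_prod :: ('k::finite option \<Rightarrow> real) measure) gauss_prod (\<lambda>w k. w (Some k)) = gauss_prod"
  "(\<lambda>w k. w (Some k)) \<in> (gauss_prod :: ('k option \<Rightarrow> real) measure) \<rightarrow>\<^sub>M gauss_prod"
proof -
  show "distr (gauss_prod :: ('k option \<Rightarrow> real) measure) gauss_prod (\<lambda>w k. w (Some k)) = gauss_prod"
    using distr_PiM_reindex[of UNIV "\<lambda>_. std_normal" "Some :: 'k \<Rightarrow> _" UNIV]
    by (simp add: prob_space_std_normal restrict_def)
  show "(\<lambda>w k. w (Some k)) \<in> (gauss_prod :: ('k option \<Rightarrow> real) measure) \<rightarrow>\<^sub>M gauss_prod"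
    by (rule measurable_PiM_single') (auto intro: measurable_component_singleton)
qed

lemma prob_transfer:
  assumes "distr M N g = N" "g \<in> M \<rightarrow>\<^sub>M N" and [measurable]: "f \<in> borel_measurable N"
  shows "\<P>(x in M. f (g x) \<le> (t::real)) = \<P>(x in N. f x \<le> t)"
proof -
  have "\<P>(x in N. f x \<le> t) = \<P>(x in distr M N g. f x \<le> t)" using assms(1) by simp
  also have "\<dots> = measure M (g -` {x \<in> space N. f x \<le> t} \<inter> space M)"
    by (subst measure_distr) (use assms(2) in auto)
  also have "g -` {x \<in> space N. f x \<le> t} \<inter> space M = {x \<in> space M. f (g x) \<le> t}"
    using measurable_space[OF assms(2)] by auto
  finally show ?thesis by simp
qed

text \<open>The difference of the sides is the product of the Cauchy-Schwarz defects of the two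
  pairs. The sides are the covariances of the decoupled process and of the bilinear form with the
  auxiliary normal.\<close>

lemma cauchy_schwarz_defect:
  fixes a a' :: "'a::real_inner" and b b' :: "'b::real_inner"
  shows "norm a * norm a' * (b \<bullet> b') + norm b * norm b' * (a \<bullet> a')
    \<le> (a \<bullet> a') * (b \<bullet> b') + norm a * norm a' * (norm b * norm b')"
proof -
  have "0 \<le> (norm a * norm a' - a \<bullet> a') * (norm b * norm b' - b \<bullet> b')"
    by (intro mult_nonneg_nonneg) (simp_all add: norm_cauchy_schwarz)
  then show ?thesis by (simp add: algebra_simps)
qed

text \<open>One of the two defects vanishes, so the covariances agree.\<close>

lemma cauchy_schwarz_defect_eq:
  fixes a a' :: "'a::real_inner" and b b' :: "'b::real_inner"
  assumes "a = a' \<or> b = b'"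
  shows "norm a * norm a' * (b \<bullet> b') + norm b * norm b' * (a \<bullet> a')
    = (a \<bullet> a') * (b \<bullet> b') + norm a * norm a' * (norm b * norm b')"
  using assms by (auto simp: norm_eq_sqrt_inner)

text \<open>The free signs and the pair-indexed \<open>a\<close>, \<open>b\<close> let one statement
  serve both parts of the theorem: exchanging the players swaps which of \<open>a\<close>,
  \<open>b\<close> is constant along a row and flips the signs. Squaring removes the signs from all
  covariances.\<close>

lemma gaussian_min_max_comparison:
  fixes A :: "'w \<Rightarrow> real^'p^'N" and V :: "'o::metric_space set" and U :: "'i::metric_space set"
    and a :: "'o \<times> 'i \<Rightarrow> real^'N" and b :: "'o \<times> 'i \<Rightarrow> real^'p"
  assumes M: "prob_space M" and ind: "indep_std_gaussians M A zg zh"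
    and V: "compact V" and U: "compact U"
    and cont: "continuous_on (V \<times> U) a" "continuous_on (V \<times> U) b" "continuous_on (V \<times> U) q"
    and same: "\<And>v u u'. a (v, u) = a (v, u') \<or> b (v, u) = b (v, u')"
    and sgn: "\<sigma>\<^sub>0 * \<sigma>\<^sub>0 = 1" "\<sigma>\<^sub>1 * \<sigma>\<^sub>1 = 1" "\<sigma>\<^sub>2 * \<sigma>\<^sub>2 = 1"
  shows "\<P>(w in M. min_max V U (\<lambda>u v. \<sigma>\<^sub>0 * (a (v, u) \<bullet> (A w *v b (v, u))) + q (v, u)) \<le> t)
    \<le> 2 * \<P>(w in M. min_max V U (\<lambda>u v. \<sigma>\<^sub>1 * (norm (a (v, u)) * (zg w \<bullet> b (v, u)))
        + \<sigma>\<^sub>2 * (norm (b (v, u)) * (zh w \<bullet> a (v, u))) + q (v, u)) \<le> t)"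
proof (cases "V = {} \<or> U = {}")
  \<comment> \<open>For an empty set both min-max values are the same constant.\<close>
  case True
  then show ?thesis by (auto simp: min_max_def)
next
  case False
  then have ne: "V \<noteq> {}" "U \<noteq> {}" by auto
  interpret prob_space "gauss_prod :: ((('N \<times> 'p) + ('p + 'N)) option \<Rightarrow> real) measure"
    by (rule prob_space_gauss_prod)
  let ?G = "gauss_prod :: ((('N \<times> 'p) + ('p + 'N)) option \<Rightarrow> real) measure"
  let ?K = "gauss_prod :: ((('N \<times> 'p) + ('p + 'N)) \<Rightarrow> real) measure"
  \<comment> \<open>The index \<open>None\<close> carries the auxiliary normal \<open>\<gamma>\<close>, with the sign \<open>s\<close> in \<open>\<beta>\<close>.\<close>
  define \<alpha> :: "'o \<times> 'i \<Rightarrow> (('N \<times> 'p) + ('p + 'N)) option \<Rightarrow> real" where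
    "\<alpha> i k = (case k of None \<Rightarrow> 0 | Some (Inl _) \<Rightarrow> 0 | Some (Inr (Inl n)) \<Rightarrow> \<sigma>\<^sub>1 * (norm (a i) * b i $ n)
      | Some (Inr (Inr m)) \<Rightarrow> \<sigma>\<^sub>2 * (norm (b i) * a i $ m))" for i k
  define \<beta> :: "real \<Rightarrow> 'o \<times> 'i \<Rightarrow> (('N \<times> 'p) + ('p + 'N)) option \<Rightarrow> real" where
    "\<beta> s i k = (case k of None \<Rightarrow> s * (norm (a i) * norm (b i)) | Some (Inl (m, n)) \<Rightarrow> \<sigma>\<^sub>0 * (a i $ m * b i $ n)
      | Some (Inr _) \<Rightarrow> 0)" for s i k
  define X where "X x u v = \<sigma>\<^sub>0 * (\<Sum>m\<in>UNIV. \<Sum>n\<in>UNIV. a (v, u) $ m * b (v, u) $ n * x (Inl (m, n))) + q (v, u)"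
    for x :: "('N \<times> 'p) + ('p + 'N) \<Rightarrow> real" and u v
  define Y where "Y x u v = \<sigma>\<^sub>1 * (norm (a (v, u)) * (\<Sum>n\<in>UNIV. x (Inr (Inl n)) * b (v, u) $ n))
        + \<sigma>\<^sub>2 * (norm (b (v, u)) * (\<Sum>m\<in>UNIV. x (Inr (Inr m)) * a (v, u) $ m)) + q (v, u)"
    for x :: "('N \<times> 'p) + ('p + 'N) \<Rightarrow> real" and u v
  have swap: "continuous_on (U \<times> V) (\<lambda>p. h (snd p, fst p))" if "continuous_on (V \<times> U) h"
    for h :: "_ \<Rightarrow> 'z::topological_space"
    by (rule continuous_on_compose2[OF that]) (auto intro!: continuous_intros)
  have nth: "continuous_on S (\<lambda>x. h x $ n)" if "continuous_on S h"
    for S :: "'z::topological_space set" and h :: "'z \<Rightarrow> real^'n" and n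
    using that by (rule bounded_linear.continuous_on[OF bounded_linear_vec_nth])
  note ci = continuous_on_add continuous_on_mult continuous_on_sum continuous_on_const continuous_on_norm nth
  have X_cont: "continuous_on (U \<times> V) (\<lambda>(u, v). X x u v)" for x
    unfolding X_def split_def by (intro ci swap cont)
  have Y_cont: "continuous_on (U \<times> V) (\<lambda>(u, v). Y x u v)" for x
    unfolding Y_def split_def by (intro ci swap cont)
  have X_meas[measurable]: "(\<lambda>x. min_max V U (X x)) \<in> borel_measurable ?K"
    by (rule borel_measurable_min_max[OF X_cont U V]) (simp add: X_def)
  have Y_meas[measurable]: "(\<lambda>x. min_max V U (Y x)) \<in> borel_measurable ?K"
    by (rule borel_measurable_min_max[OF Y_cont U V]) (simp add: Y_def)
  have X_A: "X (\<lambda>k. gaussian_entries A zg zh k w) = (\<lambda>u v. \<sigma>\<^sub>0 * (a (v, u) \<bullet> (A w *v b (v, u))) + q (v, u))" for w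
    by (simp add: X_def fun_eq_iff gaussian_entries_def inner_vec_def matrix_vector_mult_def sum_distrib_left mult_ac)
  have Y_z: "Y (\<lambda>k. gaussian_entries A zg zh k w) = (\<lambda>u v. \<sigma>\<^sub>1 * (norm (a (v, u)) * (zg w \<bullet> b (v, u)))
        + \<sigma>\<^sub>2 * (norm (b (v, u)) * (zh w \<bullet> a (v, u))) + q (v, u))" for w
    by (simp add: Y_def fun_eq_iff gaussian_entries_def inner_vec_def)
  have X_\<beta>: "(\<Sum>k\<in>UNIV. \<beta> s (v, u) k * w k) + q (v, u) = X (\<lambda>k. w (Some k)) u v + s * w None * (norm (a (v, u)) * norm (b (v, u)))" for s u v w
    unfolding sum_UNIV_option_entries by (simp add: \<beta>_def X_def sum_distrib_left mult_ac)
  have Y_\<alpha>: "(\<Sum>k\<in>UNIV. \<alpha> (v, u) k * w k) + q (v, u) = Y (\<lambda>k. w (Some k)) u v" for u v w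
    unfolding sum_UNIV_option_entries by (simp add: \<alpha>_def Y_def sum_distrib_left mult_ac)
  have \<alpha>_cont: "continuous_on (V \<times> U) (\<lambda>i. \<alpha> i k)" for k
    unfolding \<alpha>_def by (cases k; (cases "the k"; cases "projr (the k)")?) (auto intro!: ci cont)
  have \<beta>_cont: "continuous_on (V \<times> U) (\<lambda>i. \<beta> s i k)" for s k
    unfolding \<beta>_def by (cases k; (cases "the k")?) (auto intro!: ci cont simp: split_def)
  have cov_\<alpha>: "(\<Sum>k\<in>UNIV. \<alpha> i k * \<alpha> j k) = norm (a i) * norm (a j) * (b i \<bullet> b j) + norm (b i) * norm (b j) * (a i \<bullet> a j)" for i j
  proof -
    have "(\<Sum>k\<in>UNIV. \<alpha> i k * \<alpha> j k) = (\<Sum>n\<in>UNIV. (\<sigma>\<^sub>1 * \<sigma>\<^sub>1) * (norm (a i) * norm (a j)) * (b i $ n * b j $ n))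
      + (\<Sum>m\<in>UNIV. (\<sigma>\<^sub>2 * \<sigma>\<^sub>2) * (norm (b i) * norm (b j)) * (a i $ m * a j $ m))"
      unfolding sum_UNIV_option_entries by (simp add: \<alpha>_def mult_ac)
    then show ?thesis unfolding sgn by (simp add: inner_vec_def sum_distrib_left)
  qed
  have cov_\<beta>: "(\<Sum>k\<in>UNIV. \<beta> s i k * \<beta> s j k) = (a i \<bullet> a j) * (b i \<bullet> b j) + norm (a i) * norm (a j) * (norm (b i) * norm (b j))"
    if s: "s * s = 1" for s i j
  proof -
    have "(\<Sum>k\<in>UNIV. \<beta> s i k * \<beta> s j k) = (s * s) * (norm (a i) * norm (a j) * (norm (b i) * norm (b j)))
      + (\<Sum>m\<in>UNIV. \<Sum>n\<in>UNIV. (\<sigma>\<^sub>0 * \<sigma>\<^sub>0) * ((a i $ m * a j $ m) * (b i $ n * b j $ n)))"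
      unfolding sum_UNIV_option_entries by (simp add: \<beta>_def mult_ac)
    then show ?thesis unfolding sgn s by (simp add: inner_vec_def sum_product)
  qed
  have orth: "(\<Sum>k\<in>UNIV. \<alpha> i k * \<beta> s j k) = 0" for i j s
    unfolding sum_UNIV_option_entries by (simp add: \<alpha>_def \<beta>_def)
  \<comment> \<open>Gordon's inequality with the auxiliary normal entering with sign
    \<open>s\<close>; the covariance is the same for both signs.\<close>
  have G: "\<P>(w in ?G. min_max V U (\<lambda>u v. X (\<lambda>k. w (Some k)) u v + s * w None * (norm (a (v, u)) * norm (b (v, u)))) \<le> t)
      \<le> \<P>(w in ?G. min_max V U (Y (\<lambda>k. w (Some k))) \<le> t)" if s: "s * s = 1" for s
  proof -
    have "\<P>(w in ?G. min_max V U (\<lambda>u v. (\<Sum>k\<in>UNIV. \<beta> s (v, u) k * w k) + q (v, u)) \<le> t)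
      \<le> \<P>(w in ?G. min_max V U (\<lambda>u v. (\<Sum>k\<in>UNIV. \<alpha> (v, u) k * w k) + q (v, u)) \<le> t)"
    proof (rule gordon_compact[OF V ne(1) U ne(2) \<alpha>_cont \<beta>_cont cont(3) orth])
      show "(\<Sum>k\<in>UNIV. \<alpha> (v, u) k * \<alpha> (v, u') k) = (\<Sum>k\<in>UNIV. \<beta> s (v, u) k * \<beta> s (v, u') k)" for v u u'
        unfolding cov_\<alpha> cov_\<beta>[OF s] by (rule cauchy_schwarz_defect_eq[OF same])
      show "(\<Sum>k\<in>UNIV. \<alpha> i k * \<alpha> j k) \<le> (\<Sum>k\<in>UNIV. \<beta> s i k * \<beta> s j k)" for i j
        unfolding cov_\<alpha> cov_\<beta>[OF s] by (rule cauchy_schwarz_defect)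
    qed
    then show ?thesis unfolding X_\<beta> Y_\<alpha> .
  qed
  let ?S = "\<lambda>w :: (('N \<times> 'p) + ('p + 'N)) option \<Rightarrow> real. \<lambda>k. w (Some k)"
  let ?XS = "\<lambda>s w u v. X (?S w) u v + s * w None * (norm (a (v, u)) * norm (b (v, u)))"
  have XS_cont: "continuous_on (U \<times> V) (\<lambda>(u, v). ?XS s w u v)" for s w
    using X_cont[of "?S w"] unfolding split_def by (intro ci swap cont)
  have XS_meas: "(\<lambda>w. min_max V U (?XS s w)) \<in> borel_measurable ?G" for s
    by (rule borel_measurable_min_max[OF XS_cont U V]) (simp add: X_def)
  \<comment> \<open>The event passes from \<open>M\<close> to the canonical space and then to its
    enlargement by the auxiliary coordinate.\<close>
  have "\<P>(w in M. min_max V U (X (\<lambda>k. gaussian_entries A zg zh k w)) \<le> t) = \<P>(x in ?K. min_max V U (X x) \<le> t)"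
    by (rule prob_transfer[OF distr_gaussian_entries[OF M ind] X_meas])
  also have "\<dots> = \<P>(w in ?G. min_max V U (X (?S w)) \<le> t)"
    by (rule prob_transfer[OF distr_gauss_prod_Some X_meas, symmetric])
  also have "\<dots> \<le> prob ({w \<in> space ?G. min_max V U (?XS 1 w) \<le> t} \<union> {w \<in> space ?G. min_max V U (?XS (- 1) w) \<le> t})"
  proof (rule finite_measure_mono)
    show "{w \<in> space ?G. min_max V U (X (?S w)) \<le> t}
      \<subseteq> {w \<in> space ?G. min_max V U (?XS 1 w) \<le> t} \<union> {w \<in> space ?G. min_max V U (?XS (- 1) w) \<le> t}"
    proof
      fix w assume w: "w \<in> {w \<in> space ?G. min_max V U (X (?S w)) \<le> t}"
      then obtain v where v: "v \<in> V" "\<And>u. u \<in> U \<Longrightarrow> X (?S w) u v \<le> t"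
        using min_max_le_iff[OF X_cont U ne(2) V ne(1)] by blast
      \<comment> \<open>The sign is chosen against the auxiliary normal, so the extra term is
        nonpositive for all \<open>u\<close> and \<open>v\<close> simultaneously and keeps the value
        at most \<open>t\<close>.\<close>
      define s :: real where "s = (if w None \<le> 0 then 1 else - 1)"
      have "s * w None \<le> 0" by (auto simp: s_def)
      then have "?XS s w u v \<le> t" if "u \<in> U" for u
        using v(2)[OF that] mult_nonpos_nonneg[of "s * w None" "norm (a (v, u)) * norm (b (v, u))"] by simp
      then have "min_max V U (?XS s w) \<le> t"
        using min_max_le_iff[OF XS_cont U ne(2) V ne(1)] v(1) by blast
      then show "w \<in> {w \<in> space ?G. min_max V U (?XS 1 w) \<le> t} \<union> {w \<in> space ?G. min_max V U (?XS (- 1) w) \<le> t}"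
        using w by (auto simp: s_def split: if_splits)
    qed
  qed (intro sets.Un borel_measurable_le XS_meas borel_measurable_const)
  \<comment> \<open>The union bound over the two signs is the source of the factor 2.\<close>
  also have "\<dots> \<le> \<P>(w in ?G. min_max V U (?XS 1 w) \<le> t) + \<P>(w in ?G. min_max V U (?XS (- 1) w) \<le> t)"
    by (intro measure_Un_le borel_measurable_le XS_meas borel_measurable_const)
  also have "\<dots> \<le> 2 * \<P>(w in ?G. min_max V U (Y (?S w)) \<le> t)"
    using G[of 1] G[of "- 1"] by simp
  also have "\<P>(w in ?G. min_max V U (Y (?S w)) \<le> t) = \<P>(x in ?K. min_max V U (Y x) \<le> t)"
    by (rule prob_transfer[OF distr_gauss_prod_Some Y_meas])
  also have "\<dots> = \<P>(w in M. min_max V U (Y (\<lambda>k. gaussian_entries A zg zh k w)) \<le> t)"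
    by (rule prob_transfer[OF distr_gaussian_entries[OF M ind] Y_meas, symmetric])
  finally show ?thesis unfolding X_A Y_z .
qed

subsection \<open>Reduction of the conditional problem\<close>

lemma proj_perp_mult_vec: "proj_perp a *v x = x - ((a \<bullet> x) / (norm a)\<^sup>2) *\<^sub>R a"
  by (simp add: vec_eq_iff proj_perp_def matrix_vector_mult_def mat_def inner_vec_def left_diff_distrib right_diff_distrib
      sum_subtractf sum_distrib_left sum_distrib_right sum_divide_distrib if_distrib[of "(*) _"] mult_ac
      cong: if_cong)

lemma inner_proj_perp: "u \<bullet> (proj_perp a *v x) = (proj_perp a *v u) \<bullet> x"
  by (simp add: proj_perp_mult_vec inner_diff_left inner_diff_right inner_commute)

text \<open>The deterministic part of both processes.\<close>

definition rank_two :: "real^'N \<Rightarrow> real^'p \<Rightarrow> real^'p \<Rightarrow> real^'N \<Rightarrow> real^'p^'N" where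
  "rank_two u1 v1 xg xh = (\<chi> i j. xh $ i * v1 $ j / norm v1 - u1 $ i * xg $ j / norm u1)"

lemma rank_two_mult_vec:
  "rank_two u1 v1 xg xh *v v = ((v1 \<bullet> v) / norm v1) *\<^sub>R xh - ((xg \<bullet> v) / norm u1) *\<^sub>R u1"
  by (simp add: vec_eq_iff rank_two_def matrix_vector_mult_def inner_vec_def left_diff_distrib right_diff_distrib
      sum_subtractf sum_distrib_left sum_distrib_right sum_divide_distrib mult_ac)

lemma transpose_rank_two_mult_vec:
  "transpose (rank_two u1 v1 xg xh) *v u = ((xh \<bullet> u) / norm v1) *\<^sub>R v1 - ((u1 \<bullet> u) / norm u1) *\<^sub>R xg"
  by (simp add: vec_eq_iff rank_two_def matrix_vector_mult_def transpose_def inner_vec_def left_diff_distrib right_diff_distrib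
      sum_subtractf sum_distrib_left sum_distrib_right sum_divide_distrib mult_ac del: transpose_matrix_vector)

lemma xi_hat_exists:
  fixes u1 t1 :: "real^'N" and v1 s1 :: "real^'p"
  assumes nz: "u1 \<noteq> 0" "v1 \<noteq> 0" and orth: "v1 \<bullet> s1 + u1 \<bullet> t1 = 0"
  shows "\<exists>xg xh. xi_hat_eqs u1 v1 t1 s1 xg xh"
proof -
  \<comment> \<open>\<open>?xg\<close> makes the second equation hold once \<open>?xh\<close> is
    orthogonal to \<open>u1\<close>; solving the first equation for \<open>xh\<close> gives
    \<open>?xh\<close>, and \<open>orth\<close> is what makes it orthogonal to
    \<open>u1\<close>.\<close>
  let ?xg = "s1 /\<^sub>R norm u1"
  let ?xh = "t1 /\<^sub>R norm v1 + ((s1 \<bullet> v1) / ((norm u1)\<^sup>2 * norm v1)) *\<^sub>R u1"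
  have nn: "norm u1 \<noteq> 0" "norm v1 \<noteq> 0" using nz by auto
  have 1: "- ((?xg \<bullet> v1) *\<^sub>R (u1 /\<^sub>R norm u1)) + norm v1 *\<^sub>R ?xh - t1 = 0"
    using nn by (simp add: algebra_simps power2_eq_square divide_simps)
  have "t1 \<bullet> u1 = - (s1 \<bullet> v1)" using orth by (simp add: inner_commute)
  then have "?xh \<bullet> u1 = 0"
    using nn by (simp add: inner_add_left dot_square_norm divide_simps)
  then have 2: "- (norm u1 *\<^sub>R ?xg) + (?xh \<bullet> u1) *\<^sub>R (v1 /\<^sub>R norm v1) + s1 = 0"
    using nn by simp
  from 1 2 show ?thesis unfolding xi_hat_eqs_def by blast
qed

text \<open>The equations for \<open>xg\<close>, \<open>xh\<close> say that the rank-two matrix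
  satisfies the constraints. It is orthogonal to every difference of two solutions, so by Pythagoras
  its norm is minimal, and uniqueness identifies it. In particular it does not depend on the choice
  of \<open>xg\<close>, \<open>xh\<close>.\<close>

lemma min_frobenius_eq_rank_two:
  fixes u1 t1 :: "real^'N" and v1 s1 :: "real^'p"
  assumes nz: "u1 \<noteq> 0" "v1 \<noteq> 0" and orth: "v1 \<bullet> s1 + u1 \<bullet> t1 = 0"
    and xi: "xi_hat_eqs u1 v1 t1 s1 xg xh"
  shows "min_frobenius u1 v1 t1 s1 = rank_two u1 v1 xg xh"
proof (rule ccontr)
  let ?A = "min_frobenius u1 v1 t1 s1" and ?R = "rank_two u1 v1 xg xh"
  assume neq: "?A \<noteq> ?R"
  have nn: "norm u1 \<noteq> 0" "norm v1 \<noteq> 0" using nz by auto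
  have R: "?R *v v1 = t1" "transpose ?R *v u1 = - s1"
  proof -
    show "?R *v v1 = t1"
      using xi nn by (simp add: xi_hat_eqs_def rank_two_mult_vec dot_square_norm power2_eq_square divide_inverse mult_ac)
    show "transpose ?R *v u1 = - s1"
      using xi nn by (simp add: xi_hat_eqs_def transpose_rank_two_mult_vec dot_square_norm power2_eq_square divide_inverse mult_ac
        del: transpose_matrix_vector) (simp add: algebra_simps eq_neg_iff_add_eq_0)
  qed
  then have R_in: "?R \<in> cond_event u1 v1 t1 s1"
    by (simp add: cond_event_def del: transpose_matrix_vector)
  have A_in: "?A \<in> cond_event u1 v1 t1 s1" by (rule min_frobenius(1)[OF nz orth])
  define D where "D = ?A - ?R"
  have "D *v v1 = 0" "transpose D *v u1 = 0"
  proof -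
    show "D *v v1 = 0"
      using A_in R by (simp add: D_def cond_event_def matrix_vector_mult_diff_rdistrib)
    have "transpose D = transpose ?A - transpose ?R" by (simp add: D_def transpose_def vec_eq_iff)
    moreover have "transpose ?A *v u1 = - s1"
      using A_in by (simp add: cond_event_def add_eq_0_iff2 del: transpose_matrix_vector)
    ultimately show "transpose D *v u1 = 0"
      using R(2) by (simp add: matrix_vector_mult_diff_rdistrib del: transpose_matrix_vector)
  qed
  \<comment> \<open>Each rank-one summand pairs with \<open>D\<close> through \<open>D *v v1\<close>
    or \<open>transpose D *v u1\<close>, and both vanish.\<close>
  have "?R \<bullet> D = (\<Sum>i\<in>UNIV. \<Sum>j\<in>UNIV. xh $ i * v1 $ j / norm v1 * D $ i $ j) - (\<Sum>i\<in>UNIV. \<Sum>j\<in>UNIV. u1 $ i * xg $ j / norm u1 * D $ i $ j)"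
    by (simp add: rank_two_def inner_vec_def left_diff_distrib sum_subtractf)
  also have "(\<Sum>i\<in>UNIV. \<Sum>j\<in>UNIV. xh $ i * v1 $ j / norm v1 * D $ i $ j) = (xh \<bullet> (D *v v1)) / norm v1"
    by (simp add: inner_vec_def matrix_vector_mult_def sum_distrib_left sum_divide_distrib mult_ac)
  also have "(\<Sum>i\<in>UNIV. \<Sum>j\<in>UNIV. u1 $ i * xg $ j / norm u1 * D $ i $ j) = (xg \<bullet> (transpose D *v u1)) / norm u1"
    unfolding inner_vec_def matrix_vector_mult_def transpose_def
    by (subst sum.swap) (simp add: sum_distrib_left sum_divide_distrib mult_ac)
  finally have "?R \<bullet> D = 0" using \<open>D *v v1 = 0\<close> \<open>transpose D *v u1 = 0\<close> by (simp del: transpose_matrix_vector)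
  then have "(norm ?R)\<^sup>2 \<le> (norm (?R + D))\<^sup>2"
    by (simp add: power2_norm_eq_inner inner_add_left inner_add_right inner_commute)
  then have "norm ?R \<le> norm (?R + D)" by (rule power2_le_imp_le) simp
  moreover have "norm (?R + D) < norm ?R"
    using min_frobenius(2)[OF nz orth] R_in neq by (auto simp: D_def)
  ultimately show False by simp
qed

section \<open>Exchanging the two players\<close>

lemma continuous_on_uminus_flip:
  fixes f :: "'a::topological_space \<Rightarrow> 'b::topological_space \<Rightarrow> real"
  assumes "continuous_on (S \<times> T) (\<lambda>(u, v). f u v)"
  shows "continuous_on (T \<times> S) (\<lambda>(v, u). - f u v)"
  using continuous_on_minus[OF continuous_on_swap_args[OF assms]] unfolding split_def .

text \<open>Strong duality, with the max-min value written as the negative of a min-max value so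
  that the comparison lemma applies to it.\<close>

lemma min_max_minimax:
  fixes f :: "'a::euclidean_space \<Rightarrow> 'b::euclidean_space \<Rightarrow> real"
  assumes f: "continuous_on (Eu \<times> Ev) (\<lambda>(u, v). f u v)"
    and E: "compact Eu" "Eu \<noteq> {}" "convex Eu" "compact Ev" "Ev \<noteq> {}"
    and conv: "\<And>u. u \<in> Eu \<Longrightarrow> convex_on Ev (f u)"
    and conc: "\<And>v. v \<in> Ev \<Longrightarrow> concave_on Eu (\<lambda>u. f u v)"
    and t: "t \<le> min_max Ev Eu f"
  shows "min_max Eu Ev (\<lambda>v u. - f u v) \<le> - t"
\<comment> \<open>\<open>minimax_exists\<close> works with strict inequalities, so the bound is
  proved for every \<open>c\<close> above \<open>- t\<close>.\<close>
proof (rule dense_ge)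
  fix c assume "- t < c"
  then have c: "- c < min_max Ev Eu f" using t by simp
  have f': "continuous_on (Ev \<times> Eu) (\<lambda>(v, u). - f u v)"
    by (rule continuous_on_uminus_flip[OF f])
  have "\<exists>u\<in>Eu. \<forall>v\<in>Ev. - c < f u v"
  proof (rule minimax_exists[OF E(3,2,4) _ conv conc])
    show "continuous_on Ev (f u)" if "u \<in> Eu" for u
      using continuous_on_compose2[OF f, of Ev "\<lambda>v. (u, v)"] that by (force intro!: continuous_intros)
    show "\<exists>u\<in>Eu. - c < f u v" if "v \<in> Ev" for v
      using min_max_le_iff[OF f E(1,2,4,5), of "- c"] c that by (auto simp: not_le)
  qed
  then show "min_max Eu Ev (\<lambda>v u. - f u v) \<le> c"
    using min_max_le_iff[OF f' E(4,5,1,2), of c] by (fastforce simp: less_eq_real_def)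
qed

text \<open>The \<open>u\<close> optimal on the dual side secures at least \<open>t\<close> against
  every \<open>v\<close>, in particular against the \<open>v\<close> optimal on the primal
  side.\<close>

lemma min_max_weak_duality:
  fixes f :: "'a::metric_space \<Rightarrow> 'b::metric_space \<Rightarrow> real"
  assumes f: "continuous_on (Eu \<times> Ev) (\<lambda>(u, v). f u v)"
    and E: "compact Eu" "Eu \<noteq> {}" "compact Ev" "Ev \<noteq> {}"
    and t: "min_max Eu Ev (\<lambda>v u. - f u v) \<le> - t"
  shows "t \<le> min_max Ev Eu f"
proof -
  have f': "continuous_on (Ev \<times> Eu) (\<lambda>(v, u). - f u v)"
    by (rule continuous_on_uminus_flip[OF f])
  obtain u where u: "u \<in> Eu" "\<And>v. v \<in> Ev \<Longrightarrow> t \<le> f u v"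
    using t min_max_le_iff[OF f' E(3,4,1,2), of "- t"] by auto
  obtain v where "v \<in> Ev" "\<And>u. u \<in> Eu \<Longrightarrow> f u v \<le> min_max Ev Eu f"
    using min_max_le_iff[OF f E, of "min_max Ev Eu f"] by auto
  with u show ?thesis by (meson order_trans)
qed

section \<open>Measurability, the conditional law and the two bilinear forms\<close>

lemma borel_measurable_matrix:
  fixes A :: "'w \<Rightarrow> real^'p^'N"
  assumes "\<And>i j. (\<lambda>w. A w $ i $ j) \<in> borel_measurable M"
  shows "A \<in> borel_measurable M"
proof (rule borel_measurable_euclidean_space[THEN iffD2], rule ballI)
  fix b :: "real^'p^'N" assume "b \<in> Basis"
  then obtain i j where "b = axis i (axis j 1)" by (auto simp: Basis_vec_def)
  then show "(\<lambda>x. A x \<bullet> b) \<in> borel_measurable M" by (simp add: inner_axis assms)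
qed

lemma continuous_on_bilinear_form:
  fixes B :: "real^'p^'N"
  shows "continuous_on S (\<lambda>(u, v). u \<bullet> (B *v v))"
proof -
  have "continuous_on S (\<lambda>p. B *v snd p)"
    by (rule continuous_on_compose2[OF matrix_vector_mult_linear_continuous_on
          continuous_on_snd[OF continuous_on_id] subset_UNIV])
  from continuous_on_inner[OF continuous_on_fst[OF continuous_on_id] this]
  show ?thesis unfolding split_def .
qed

lemma indep_std_gaussians_measurable:
  fixes A :: "'w \<Rightarrow> real^'p^'N"
  assumes "indep_std_gaussians M A zg zh"
  shows "(\<lambda>w. A w $ i $ j) \<in> borel_measurable M" "(\<lambda>w. zg w $ j) \<in> borel_measurable M"
    "(\<lambda>w. zh w $ i) \<in> borel_measurable M"
proof -
  have m: "gaussian_entries A zg zh k \<in> borel_measurable M" for k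
  proof -
    have "distributed M lborel (gaussian_entries A zg zh k) std_normal_density"
      using assms by (auto simp: indep_std_gaussians_def)
    from distributed_measurable[OF this] show ?thesis by simp
  qed
  show "(\<lambda>w. A w $ i $ j) \<in> borel_measurable M" "(\<lambda>w. zg w $ j) \<in> borel_measurable M"
    "(\<lambda>w. zh w $ i) \<in> borel_measurable M"
    using m[of "Inl (i, j)"] m[of "Inr (Inl j)"] m[of "Inr (Inr i)"]
    by (simp_all add: gaussian_entries_def[abs_def])
qed

lemma prob_gaussian_cond_law:
  fixes u1 t1 :: "real^'N" and v1 s1 :: "real^'p" and A :: "'w \<Rightarrow> real^'p^'N"
  assumes M: "prob_space M" and ind: "indep_std_gaussians M A zg zh"
    and S: "{B. P B} \<in> sets borel"
  shows "\<P>(B in gaussian_cond_law M A u1 v1 t1 s1. P B)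
    = \<P>(w in M. P (min_frobenius u1 v1 t1 s1 + proj_perp u1 ** A w ** proj_perp v1))"
proof -
  interpret prob_space M by fact
  let ?T = "\<lambda>w. min_frobenius u1 v1 t1 s1 + proj_perp u1 ** A w ** proj_perp v1"
  note [measurable] = indep_std_gaussians_measurable[OF ind]
  have "?T \<in> borel_measurable M"
    by (rule borel_measurable_matrix) (simp add: matrix_matrix_mult_def)
  then have "measure (distr M borel ?T) {B. P B} = measure M (?T -` {B. P B} \<inter> space M)"
    using S by (rule measure_distr)
  also have "?T -` {B. P B} \<inter> space M = {w \<in> space M. P (?T w)}" by auto
  finally show ?thesis by (simp add: gaussian_cond_law_def)
qed

text \<open>The projections are self-adjoint, so the left one moves onto \<open>u\<close>, and the
  minimum norm matrix is the rank-two one.\<close>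

lemma cond_bilinear_form:
  fixes u1 t1 :: "real^'N" and v1 s1 :: "real^'p"
  assumes "u1 \<noteq> 0" "v1 \<noteq> 0" "v1 \<bullet> s1 + u1 \<bullet> t1 = 0" "xi_hat_eqs u1 v1 t1 s1 xg xh"
  shows "u \<bullet> ((min_frobenius u1 v1 t1 s1 + proj_perp u1 ** A ** proj_perp v1) *v v)
    = (proj_perp u1 *v u) \<bullet> (A *v (proj_perp v1 *v v)) + u \<bullet> (rank_two u1 v1 xg xh *v v)"
  unfolding min_frobenius_eq_rank_two[OF assms] matrix_vector_mult_add_rdistrib inner_add_right
    matrix_vector_mul_assoc[symmetric] inner_proj_perp by (rule add.commute)

text \<open>The \<open>xg\<close> and \<open>xh\<close> terms combine to the same rank-two form as
  under the conditional law; in the random terms the projections move from the noise onto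
  \<open>u\<close> and \<open>v\<close>.\<close>

lemma cg_bilinear_form:
  "- (g_cg u1 v1 xg zg u \<bullet> v) + h_cg u1 v1 xh zh v \<bullet> u
    = - (norm (proj_perp u1 *v u) * (zg \<bullet> (proj_perp v1 *v v)))
      + norm (proj_perp v1 *v v) * (zh \<bullet> (proj_perp u1 *v u)) + u \<bullet> (rank_two u1 v1 xg xh *v v)"
proof -
  have "(proj_perp v1 *v zg) \<bullet> v = zg \<bullet> (proj_perp v1 *v v)"
    "(proj_perp u1 *v zh) \<bullet> u = zh \<bullet> (proj_perp u1 *v u)"
    by (rule inner_proj_perp[symmetric])+
  then show ?thesis
    unfolding g_cg_def h_cg_def rank_two_mult_vec inner_add_left inner_diff_right inner_scaleR_left
      inner_scaleR_right
    by (simp add: inner_commute[of u])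
qed

theorem lemmaL2:
  fixes u1 t1 :: "real^'N" and v1 s1 :: "real^'p"
    and M :: "'w measure"
    and A :: "'w \<Rightarrow> real^'p^'N" and zg :: "'w \<Rightarrow> real^'p" and zh :: "'w \<Rightarrow> real^'N"
    and \<psi> :: "real^'N \<Rightarrow> real^'p \<Rightarrow> real"
  assumes "u1 \<noteq> 0" and "v1 \<noteq> 0"
    and "v1 \<bullet> s1 + u1 \<bullet> t1 = 0"
    and "prob_space M"
    and "indep_std_gaussians M A zg zh"
    and "continuous_on UNIV (\<lambda>(u, v). \<psi> u v)"
    and "\<And>v. concave_on UNIV (\<lambda>u. \<psi> u v)"
    and "\<And>u. convex_on UNIV (\<lambda>v. \<psi> u v)"
  shows "(\<exists>xg xh. xi_hat_eqs u1 v1 t1 s1 xg xh) \<and>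
    (\<forall>xg xh. xi_hat_eqs u1 v1 t1 s1 xg xh \<longrightarrow>
      (\<forall>Eu Ev t. compact Eu \<and> compact Ev \<longrightarrow>
        \<P>(B in gaussian_cond_law M A u1 v1 t1 s1.
            min_max Ev Eu (\<lambda>u v. u \<bullet> (B *v v) + \<psi> u v) \<le> t)
        \<le> 2 * \<P>(\<omega> in M. min_max Ev Eu (\<lambda>u v. - (g_cg u1 v1 xg (zg \<omega>) u \<bullet> v)
                + h_cg u1 v1 xh (zh \<omega>) v \<bullet> u + \<psi> u v) \<le> t)) \<and>
      (\<forall>Eu Ev t. compact Eu \<and> convex Eu \<and> compact Ev \<and> convex Ev \<longrightarrow>
        \<P>(B in gaussian_cond_law M A u1 v1 t1 s1.
            min_max Ev Eu (\<lambda>u v. u \<bullet> (B *v v) + \<psi> u v) \<ge> t)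
        \<le> 2 * \<P>(\<omega> in M. min_max Ev Eu (\<lambda>u v. - (g_cg u1 v1 xg (zg \<omega>) u \<bullet> v)
                + h_cg u1 v1 xh (zh \<omega>) v \<bullet> u + \<psi> u v) \<ge> t)))"
proof (intro conjI allI impI)
  show "\<exists>xg xh. xi_hat_eqs u1 v1 t1 s1 xg xh" by (rule xi_hat_exists) fact+
next
  fix xg xh
  assume xi: "xi_hat_eqs u1 v1 t1 s1 xg xh"
  note M = \<open>prob_space M\<close> and ind = \<open>indep_std_gaussians M A zg zh\<close>
  interpret prob_space M by fact
  let ?T = "\<lambda>w. min_frobenius u1 v1 t1 s1 + proj_perp u1 ** A w ** proj_perp v1"
  \<comment> \<open>\<open>a\<close> and \<open>b\<close> enter the random parts, while
    \<open>q\<close> collects the deterministic form and \<psi>; the conditional and the comparison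
    process share the same \<open>q\<close>.\<close>
  define a where "a u = proj_perp u1 *v u" for u
  define b where "b v = proj_perp v1 *v v" for v
  define q where "q u v = u \<bullet> (rank_two u1 v1 xg xh *v v) + \<psi> u v" for u v
  define F where "F B u v = u \<bullet> (B *v v) + \<psi> u v" for B u v
  define Y where "Y w u v = - (g_cg u1 v1 xg (zg w) u \<bullet> v) + h_cg u1 v1 xh (zh w) v \<bullet> u + \<psi> u v" for w u v
  have F_eq: "F (?T w) u v = a u \<bullet> (A w *v b v) + q u v" for w u v
    unfolding F_def a_def b_def q_def using cond_bilinear_form[OF assms(1,2,3) xi] by simp
  have Y_eq: "Y w u v = - (norm (a u) * (zg w \<bullet> b v)) + norm (b v) * (zh w \<bullet> a u) + q u v" for w u v
    unfolding Y_def a_def b_def q_def cg_bilinear_form by simp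
  have \<psi>_cont: "continuous_on S (\<lambda>(u, v). \<psi> u v)" for S
    by (rule continuous_on_subset[OF \<open>continuous_on UNIV (\<lambda>(u, v). \<psi> u v)\<close>]) simp
  have F_cont: "continuous_on S (\<lambda>(u, v). F B u v)" for S B
    using continuous_on_add[OF continuous_on_bilinear_form[of S B] \<psi>_cont] by (simp add: F_def split_def)
  have q_cont: "continuous_on S (\<lambda>(u, v). q u v)" for S
    using continuous_on_add[OF continuous_on_bilinear_form \<psi>_cont] by (simp add: q_def split_def)
  have a_cont: "continuous_on S (\<lambda>x. a (f x))" if "continuous_on S f" for S :: "'z::topological_space set" and f
    unfolding a_def by (rule continuous_on_compose2[OF matrix_vector_mult_linear_continuous_on[of UNIV] that]) simp
  have b_cont: "continuous_on S (\<lambda>x. b (f x))" if "continuous_on S f" for S :: "'z::topological_space set" and f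
    unfolding b_def by (rule continuous_on_compose2[OF matrix_vector_mult_linear_continuous_on[of UNIV] that]) simp
  have Y_cont: "continuous_on S (\<lambda>(u, v). Y w u v)" for S w
    unfolding Y_eq using q_cont[of S] unfolding split_def
    by (intro continuous_on_add continuous_on_minus continuous_on_mult continuous_on_norm continuous_on_inner
        continuous_on_const a_cont b_cont continuous_on_fst continuous_on_snd continuous_on_id)
  note [measurable] = indep_std_gaussians_measurable[OF ind]
  have F_meas: "(\<lambda>B. min_max Ev Eu (F B)) \<in> borel_measurable borel" if "compact Eu" "compact Ev" for Eu Ev
  proof (rule borel_measurable_min_max[OF F_cont that])
    fix u v
    have "continuous_on UNIV (\<lambda>B::real^'p^'N. F B u v)"
      unfolding F_def matrix_vector_mult_def inner_vec_def
      by (intro continuous_intros)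
    then show "(\<lambda>B. F B u v) \<in> borel_measurable borel" by (rule borel_measurable_continuous_onI)
  qed
  have Y_meas: "(\<lambda>w. min_max Ev Eu (Y w)) \<in> borel_measurable M" if "compact Eu" "compact Ev" for Eu Ev
    by (rule borel_measurable_min_max[OF Y_cont that]) (simp add: Y_eq inner_vec_def)
  have F_law_ge: "\<P>(B in gaussian_cond_law M A u1 v1 t1 s1. min_max Ev Eu (F B) \<ge> t) = \<P>(w in M. min_max Ev Eu (F (?T w)) \<ge> t)"
    if E: "compact Eu" "compact Ev" for Eu :: "(real^'N) set" and Ev :: "(real^'p) set" and t
    using borel_measurable_le[OF borel_measurable_const[of t] F_meas[OF E]]
    by (intro prob_gaussian_cond_law[OF M ind]) simp
  show "\<P>(B in gaussian_cond_law M A u1 v1 t1 s1. min_max Ev Eu (\<lambda>u v. u \<bullet> (B *v v) + \<psi> u v) \<le> t)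
        \<le> 2 * \<P>(\<omega> in M. min_max Ev Eu (\<lambda>u v. - (g_cg u1 v1 xg (zg \<omega>) u \<bullet> v)
                + h_cg u1 v1 xh (zh \<omega>) v \<bullet> u + \<psi> u v) \<le> t)"
    if "compact Eu \<and> compact Ev" for Eu Ev t
  proof -
    have E: "compact Eu" "compact Ev" using that by auto
    have "\<P>(B in gaussian_cond_law M A u1 v1 t1 s1. min_max Ev Eu (F B) \<le> t) = \<P>(w in M. min_max Ev Eu (F (?T w)) \<le> t)"
      using borel_measurable_le[OF F_meas[OF E] borel_measurable_const[of t]]
      by (intro prob_gaussian_cond_law[OF M ind]) simp
    \<comment> \<open>The index pair lists the minimising variable first, so \<open>u\<close> is its
      second component; the signs are 1 for the matrix and -1, 1 for the comparison process.\<close>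
    also have "\<dots> = \<P>(w in M. min_max Ev Eu (\<lambda>u v. 1 * (a (snd (v, u)) \<bullet> (A w *v b (fst (v, u)))) + q (snd (v, u)) (fst (v, u))) \<le> t)"
      unfolding F_eq[abs_def] by simp
    also have "\<dots> \<le> 2 * \<P>(w in M. min_max Ev Eu (\<lambda>u v. (- 1) * (norm (a (snd (v, u))) * (zg w \<bullet> b (fst (v, u))))
        + 1 * (norm (b (fst (v, u))) * (zh w \<bullet> a (snd (v, u)))) + q (snd (v, u)) (fst (v, u))) \<le> t)"
    proof (rule gaussian_min_max_comparison[OF M ind E(2,1)])
      show "continuous_on (Ev \<times> Eu) (\<lambda>i. q (snd i) (fst i))"
        using continuous_on_compose2[OF q_cont[of UNIV] continuous_on_swap[of "Ev \<times> Eu"]] by (simp add: split_def prod.swap_def)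
    qed (auto intro!: a_cont b_cont continuous_intros)
    also have "\<dots> = 2 * \<P>(w in M. min_max Ev Eu (Y w) \<le> t)"
      unfolding Y_eq[abs_def] by simp
    finally show ?thesis unfolding F_def Y_def .
  qed
  show "\<P>(B in gaussian_cond_law M A u1 v1 t1 s1. min_max Ev Eu (\<lambda>u v. u \<bullet> (B *v v) + \<psi> u v) \<ge> t)
        \<le> 2 * \<P>(\<omega> in M. min_max Ev Eu (\<lambda>u v. - (g_cg u1 v1 xg (zg \<omega>) u \<bullet> v)
                + h_cg u1 v1 xh (zh \<omega>) v \<bullet> u + \<psi> u v) \<ge> t)"
    if "compact Eu \<and> convex Eu \<and> compact Ev \<and> convex Ev" for Eu Ev t
  proof -
    have E: "compact Eu" "convex Eu" "compact Ev" "convex Ev" using that by auto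
    have "\<P>(B in gaussian_cond_law M A u1 v1 t1 s1. min_max Ev Eu (F B) \<ge> t) \<le> 2 * \<P>(w in M. min_max Ev Eu (Y w) \<ge> t)"
    proof (cases "Eu = {} \<or> Ev = {}")
      case True
      \<comment> \<open>With an empty set the value is the same default for every payoff, so both
        events have equal probability.\<close>
      define c where "c = min_max Ev Eu (\<lambda>_ _. 0)"
      have "min_max Ev Eu f = c" for f
        using True by (auto simp: min_max_def c_def)
      then show ?thesis unfolding F_law_ge[OF E(1,3)] by simp
    next
      case False
      then have ne: "Eu \<noteq> {}" "Ev \<noteq> {}" by auto
      have convF: "convex_on Ev (F B u)" for B u
      proof -
        have "convex_on Ev (\<lambda>v. u \<bullet> (B *v v))"
          using E(4) by (simp add: convex_on_def matrix_vector_right_distrib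
              matrix_vector_mult_scaleR inner_add_right)
        moreover have "convex_on Ev (\<psi> u)"
          by (rule convex_on_subset[OF \<open>convex_on UNIV (\<lambda>v. \<psi> u v)\<close>]) (use E in auto)
        ultimately show ?thesis unfolding F_def by (rule convex_on_add)
      qed
      have concF: "concave_on Eu (\<lambda>u. F B u v)" for B v
      proof -
        have "convex_on Eu (\<lambda>u. - (u \<bullet> (B *v v)))"
          using E(2) by (simp add: convex_on_def inner_add_left)
        moreover have "convex_on Eu (\<lambda>u. - \<psi> u v)"
          by (rule convex_on_subset[OF \<open>concave_on UNIV (\<lambda>u. \<psi> u v)\<close>[unfolded concave_on_def]]) (use E in auto)
        ultimately have "convex_on Eu (\<lambda>u. - (u \<bullet> (B *v v)) + - \<psi> u v)" by (rule convex_on_add)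
        then show ?thesis by (simp add: F_def concave_on_def)
      qed
      have "(\<lambda>w. min_max Eu Ev (\<lambda>v u. - F (?T w) u v)) \<in> borel_measurable M"
        by (rule borel_measurable_min_max[OF continuous_on_uminus_flip[OF F_cont] E(3,1)])
          (simp add: F_eq inner_vec_def matrix_vector_mult_def)
      then have neg_meas: "{w \<in> space M. min_max Eu Ev (\<lambda>v u. - F (?T w) u v) \<le> - t} \<in> sets M"
        by (intro borel_measurable_le borel_measurable_const)
      have "\<P>(B in gaussian_cond_law M A u1 v1 t1 s1. min_max Ev Eu (F B) \<ge> t) = \<P>(w in M. min_max Ev Eu (F (?T w)) \<ge> t)"
        by (rule F_law_ge[OF E(1,3)])
      \<comment> \<open>The minimax theorem applies for each outcome, since \<open>F\<close> is
        convex-concave for every fixed matrix.\<close>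
      also have "\<dots> \<le> \<P>(w in M. min_max Eu Ev (\<lambda>v u. - F (?T w) u v) \<le> - t)"
        using min_max_minimax[OF F_cont E(1) ne(1) E(2,3) ne(2) convF concF]
        by (intro finite_measure_mono[OF _ neg_meas]) auto
      \<comment> \<open>Now \<open>u\<close> is the minimising variable and comes first in the index
        pair; negating the payoff reverses all three signs.\<close>
      also have "\<dots> = \<P>(w in M. min_max Eu Ev (\<lambda>v u. (- 1) * (a (fst (u, v)) \<bullet> (A w *v b (snd (u, v)))) + - q (fst (u, v)) (snd (u, v))) \<le> - t)"
        unfolding F_eq[abs_def] by simp
      also have "\<dots> \<le> 2 * \<P>(w in M. min_max Eu Ev (\<lambda>v u. 1 * (norm (a (fst (u, v))) * (zg w \<bullet> b (snd (u, v))))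
          + (- 1) * (norm (b (snd (u, v))) * (zh w \<bullet> a (fst (u, v)))) + - q (fst (u, v)) (snd (u, v))) \<le> - t)"
      proof (rule gaussian_min_max_comparison[OF M ind E(1,3)])
        show "continuous_on (Eu \<times> Ev) (\<lambda>i. - q (fst i) (snd i))"
          using continuous_on_minus[OF q_cont] by (simp add: split_def)
      qed (auto intro!: a_cont b_cont continuous_intros)
      also have "\<dots> = 2 * \<P>(w in M. min_max Eu Ev (\<lambda>v u. - Y w u v) \<le> - t)"
        unfolding Y_eq[abs_def] by (simp add: algebra_simps)
      \<comment> \<open>\<open>Y\<close> need not be convex-concave, so the way back uses only weak
        duality, which is the direction required.\<close>
      also have "\<dots> \<le> 2 * \<P>(w in M. min_max Ev Eu (Y w) \<ge> t)"
      proof -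
        have "\<P>(w in M. min_max Eu Ev (\<lambda>v u. - Y w u v) \<le> - t) \<le> \<P>(w in M. min_max Ev Eu (Y w) \<ge> t)"
          using min_max_weak_duality[OF Y_cont E(1) ne(1) E(3) ne(2)]
          by (intro finite_measure_mono borel_measurable_le Y_meas[OF E(1,3)] borel_measurable_const) auto
        then show ?thesis by simp
      qed
      finally show ?thesis .
    qed
    then show ?thesis unfolding F_def Y_def .
  qed
qed

end
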